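(* There exists a quasiregular mapping $f : \mathbb{R}^2 \to \mathbb{R}^2$ with an essential singularity at infinity such that the closure $\overline{I(f)}$ of the escaping set $$I(f) = \{ x \in \mathbb{R}^2 : \lim_{n \to \infty} f^n(x) = \infty \}$$ has a bounded component.
   Context: A continuous mapping $f : \mathbb{R}^2 \to \mathbb{R}^2$ is called quasiregular if it belongs to the Sobolev space $W^{1}_{2,\mathrm{loc}}(\mathbb{R}^2)$ and there is a constant $K \in [1,\infty)$ such that $|f'(x)|^2 \leq K J_f(x)$ for almost every $x$, where $|f'(x)|$ is the operator norm of the derivative and $J_f$ is the Jacobian determinant. It has an essential singularity at infinity if $f(x)$ has no limit in $\mathbb{R}^2 \cup \{\infty\}$ as $x \to \infty$. Here $f^1 = f$ and $f^{n+1} = f \circ f^n$. "Component" means (non-empty) connected component. *)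

theory Defs
  imports "HOL-Analysis.Analysis"
begin

primrec C_k :: "nat \<Rightarrow> (real^2 \<Rightarrow> real) \<Rightarrow> bool" where
  "C_k 0 \<phi> \<longleftrightarrow> continuous_on UNIV \<phi>"
| "C_k (Suc k) \<phi> \<longleftrightarrow> (\<forall>x. \<phi> differentiable (at x)) \<and>
     (\<forall>j. C_k k (\<lambda>x. frechet_derivative \<phi> (at x) (axis j 1)))"

definition test_function :: "(real^2 \<Rightarrow> real) \<Rightarrow> bool" where
  "test_function \<phi> \<longleftrightarrow> (\<forall>k. C_k k \<phi>) \<and> compact (closure {x. \<phi> x \<noteq> 0})"

definition L2_loc :: "(real^2 \<Rightarrow> real) \<Rightarrow> bool" where
  "L2_loc g \<longleftrightarrow> g \<in> borel_measurable lebesgue \<and>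
     (\<forall>S. compact S \<longrightarrow> set_integrable lebesgue S (\<lambda>x. (g x)\<^sup>2))"

text \<open>The matrix entry \<open>D x $ i $ j\<close> is the weak partial derivative of the \<open>i\<close>-th
  component of \<open>f\<close> in the \<open>j\<close>-th coordinate direction. The Bochner integral of a
  non-integrable function is 0, so this is meaningful only for locally integrable \<open>f\<close> and
  \<open>D\<close>; below both are in \<open>L2_loc\<close>.\<close>

definition weak_derivative :: "(real^2 \<Rightarrow> real^2) \<Rightarrow> (real^2 \<Rightarrow> real^2^2) \<Rightarrow> bool" where
  "weak_derivative f D \<longleftrightarrow> (\<forall>i j \<phi>. test_function \<phi> \<longrightarrow>
     (LINT x|lebesgue. f x $ i * frechet_derivative \<phi> (at x) (axis j 1))
       = - (LINT x|lebesgue. D x $ i $ j * \<phi> x))"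

text \<open>Membership of \<open>f\<close> in the Sobolev space \<open>W\<^sup>1\<^sub>2\<^sub>,\<^sub>l\<^sub>o\<^sub>c\<close>, with the weak derivative \<open>D\<close> (unique
  up to null sets) made explicit.\<close>

definition W12_loc_with :: "(real^2 \<Rightarrow> real^2) \<Rightarrow> (real^2 \<Rightarrow> real^2^2) \<Rightarrow> bool" where
  "W12_loc_with f D \<longleftrightarrow> (\<forall>i. L2_loc (\<lambda>x. f x $ i)) \<and>
     (\<forall>i j. L2_loc (\<lambda>x. D x $ i $ j)) \<and> weak_derivative f D"

definition quasiregular :: "(real^2 \<Rightarrow> real^2) \<Rightarrow> bool" where
  "quasiregular f \<longleftrightarrow> continuous_on UNIV f \<and>
     (\<exists>D. W12_loc_with f D \<and>
        (\<exists>K\<ge>1. AE x in lebesgue. (onorm ((*v) (D x)))\<^sup>2 \<le> K * det (D x)))"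

definition essential_singularity_at_infinity :: "(real^2 \<Rightarrow> real^2) \<Rightarrow> bool" where
  "essential_singularity_at_infinity f \<longleftrightarrow>
     \<not> (\<exists>l. (f \<longlongrightarrow> l) at_infinity) \<and> \<not> filterlim f at_infinity at_infinity"

definition escaping_set :: "(real^2 \<Rightarrow> real^2) \<Rightarrow> (real^2) set" where
  "escaping_set f = {x. filterlim (\<lambda>n. (f ^^ n) x) at_infinity sequentially}"

end

theory Submission
  imports Defs
begin

text \<open>
  A homeomorphism \<open>disc_map\<close> of the closed unit disc fixing \<open>1\<close> pushes circles about \<open>0\<close>
  outwards, \<open>(1 - r) / r\<close> being divided by \<open>6/5\<close>, and rotates them forward by an angle which
  is comparable to \<open>\<bar>1 - w\<bar>\<close> except near the points of a single orbit on the real axis, where it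
  vanishes. That orbit tends to \<open>1\<close>. On an invariant union of annuli the rotation is too strong
  for orbits to tend to \<open>1\<close>: such an orbit would have to approach \<open>1\<close> from below, with arguments
  tending to \<open>0\<close> faster than its distance to the unit circle, which bounds the rotation from below.
  The Cayley transform takes \<open>1\<close> to \<open>\<infinity>\<close> and the disc to the right half-plane, where we obtain an
  escaping point enclosed by a circle that is disjoint from the closure of the escaping set.
  Reflection extends the map to a quasiconformal map of the plane, and composing it with a map which
  is the identity on the right half-plane and \<open>u + exp (-u) / 60\<close> on \<open>Re u \<le> -1\<close> creates the
  essential singularity without changing the dynamics on the right.
\<close>

section \<open>Weak derivatives from derivatives off a null set\<close>

text \<open>The contradiction on the annuli is a competition of rates. One step multiplies
  \<open>1 - cmod w\<close> by at least 5/6, while a rotation by at least a quarter of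
  \<open>cmod (1 - w)\<close> would multiply the argument of an orbit tending to 1 eventually by at
  most 4/5. Since 4/5 < 5/6, the argument would become too small; this is why the radial expansion
  6/5 must be so mild. The obstacle is to let some point escape inside the barrier while keeping the
  distortion bounded. The rotation is therefore weakened by a term that oscillates infinitely often
  near the unit circle, with amplitude proportional to the distance to the circle and period
  constant in \<open>ln (r / (1 - r))\<close>. In logarithmic coordinates its derivative stays
  bounded, so the map remains quasiconformal up to the circle. Classical derivatives are established
  only off the imaginary axis, where the reflection glues, and off two points over the centre of the
  disc. The Sobolev condition is therefore derived from continuity together with derivatives off a
  small exceptional set.\<close>

lemma integral_lim_difference_quotient_eq_0:
  fixes g d :: "'a::euclidean_space \<Rightarrow> real"
  assumes cont: "continuous_on UNIV g"
    and supp: "\<And>x. norm x > R \<Longrightarrow> g x = 0"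
    and e: "norm e \<le> 1"
    and d: "d \<in> borel_measurable borel"
    and lim: "AE x in lborel. (\<lambda>n. (g (x + (1 / Suc n) *\<^sub>R e) - g x) * Suc n) \<longlonglongrightarrow> d x"
    and bound: "\<And>n. AE x in lborel. \<bar>(g (x + (1 / Suc n) *\<^sub>R e) - g x) * Suc n\<bar> \<le> B"
  shows "integrable lborel d" "(LINT x|lborel. d x) = 0"
proof -
  let ?s = "\<lambda>n x. (g (x + (1 / Suc n) *\<^sub>R e) - g x) * Suc n"
  let ?w = "\<lambda>x. indicator (cball 0 (R + 1)) x *\<^sub>R B"
  have gm [measurable]: "g \<in> borel_measurable borel"
    using cont by (rule borel_measurable_continuous_onI)
  have int_g: "integrable lborel g"
  proof -
    have "integrable lborel (\<lambda>x. indicator (cball 0 R) x *\<^sub>R g x)"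
      by (rule borel_integrable_compact) (use cont continuous_on_subset in auto)
    moreover have "(\<lambda>x. indicator (cball 0 R) x *\<^sub>R g x) = g"
      using supp by (force simp: indicator_def fun_eq_iff not_le)
    ultimately show ?thesis by metis
  qed
  have shift: "has_bochner_integral lborel (\<lambda>x. g (x + v)) (LINT x|lborel. g x)" for v
  proof -
    have "has_bochner_integral (distr lborel borel ((+) v)) g (LINT x|lborel. g x)"
      using int_g by (simp add: lborel_distr_plus has_bochner_integral_integrable)
    then show ?thesis
      by (simp add: has_bochner_integral_iff integrable_distr_eq integral_distr add.commute)
  qed
  \<comment> \<open>Translation invariance: both terms of the quotient have the same integral.
    Carried to the limit by dominated convergence, this takes the place of integration by
    parts.\<close>
  have int_s: "(LINT x|lborel. ?s n x) = 0" for n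
  proof -
    have "has_bochner_integral lborel (?s n) ((integral\<^sup>L lborel g - integral\<^sup>L lborel g) * Suc n)"
      by (intro has_bochner_integral_mult_left has_bochner_integral_diff shift
          has_bochner_integral_integrable int_g)
    then show ?thesis by (simp add: has_bochner_integral_iff)
  qed
  have w: "integrable lborel ?w"
    by (rule borel_integrable_compact) auto
  \<comment> \<open>A shift by a vector of norm at most 1 enlarges the support by at most 1, whence
    the radius \<open>R + 1\<close> of the dominating function.\<close>
  have sw: "AE x in lborel. norm (?s n x) \<le> ?w x" for n
    using bound[of n]
  proof eventually_elim
    case (elim x)
    show ?case
    proof (cases "norm x \<le> R + 1")
      case True
      then show ?thesis using elim by (simp add: indicator_def)
    next
      case False
      define u where "u = (1 / real (Suc n)) *\<^sub>R e"
      have "norm u \<le> 1 * 1"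
        unfolding u_def norm_scaleR using e by (intro mult_mono) auto
      then have "norm (x + u) > R"
        using norm_triangle_ineq2[of x "- u"] False by simp
      then show ?thesis using supp[of x] supp[of "x + u"] False by (simp add: indicator_def u_def)
    qed
  qed
  have dm: "d \<in> borel_measurable lborel" using d by simp
  have sm: "?s n \<in> borel_measurable lborel" for n by measurable
  show "integrable lborel d"
    by (rule integrable_dominated_convergence[OF dm sm w lim sw])
  have "(\<lambda>n. LINT x|lborel. ?s n x) \<longlonglongrightarrow> (LINT x|lborel. d x)"
    by (rule integral_dominated_convergence[OF dm sm w lim sw])
  then show "(LINT x|lborel. d x) = 0"
    unfolding int_s by (simp add: LIMSEQ_const_iff)
qed

text \<open>The fundamental theorem of calculus tolerates finitely many exceptional parameters
  because \<open>h\<close> is continuous across them. The result is applied to segments that cross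
  the exceptional set of a map.\<close>

lemma norm_diff_le_of_derivative_bound_off_finite:
  fixes h :: "real \<Rightarrow> 'a::banach"
  assumes "finite S" "0 \<le> a" "continuous_on {0..a} h" "0 \<le> B"
    and der: "\<And>t. t \<notin> S \<Longrightarrow> (h has_vector_derivative h' t) (at t)"
    and bd: "\<And>t. t \<notin> S \<Longrightarrow> norm (h' t) \<le> B"
  shows "norm (h a - h 0) \<le> B * a"
proof -
  have "(h' has_integral (h a - h 0)) {0..a}"
    using assms(1-3) der by (intro fundamental_theorem_of_calculus_strong) auto
  then have "((\<lambda>t. if t \<in> S then 0 else h' t) has_integral (h a - h 0)) (cbox 0 a)"
    using assms(1) by (simp add: cbox_interval) (rule has_integral_spike_finite, auto)
  then have "norm (h a - h 0) \<le> B * measure lborel (cbox 0 a)"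
    using assms(4) bd by (intro has_integral_bound) auto
  then show ?thesis using \<open>0 \<le> a\<close> by simp
qed

lemma test_functionD:
  assumes "test_function \<phi>"
  shows "continuous_on UNIV \<phi>"
    and "(\<phi> has_derivative frechet_derivative \<phi> (at x)) (at x)"
    and "continuous_on UNIV (\<lambda>x. frechet_derivative \<phi> (at x) (axis j 1))"
    and "\<exists>R>0. \<forall>x. norm x > R \<longrightarrow> \<phi> x = 0 \<and> frechet_derivative \<phi> (at x) (axis j 1) = 0"
proof -
  have C: "C_k k \<phi>" for k
    using assms unfolding test_function_def by blast
  note C = C[of 0] C[of "Suc 0"]
  show "continuous_on UNIV \<phi>" using C by simp
  show "(\<phi> has_derivative frechet_derivative \<phi> (at x)) (at x)"
    using C by (simp add: frechet_derivative_works)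
  show "continuous_on UNIV (\<lambda>x. frechet_derivative \<phi> (at x) (axis j 1))"
    using C by simp
  have "bounded (closure {x. \<phi> x \<noteq> 0})"
    using assms by (simp add: test_function_def compact_imp_bounded)
  then obtain R where R: "R > 0" "\<And>x. x \<in> closure {x. \<phi> x \<noteq> 0} \<Longrightarrow> norm x \<le> R"
    unfolding bounded_pos by blast
  have 0: "\<phi> x = 0" if "norm x > R" for x
  proof (rule ccontr)
    assume "\<phi> x \<noteq> 0"
    then have "x \<in> closure {x. \<phi> x \<noteq> 0}"
      by (intro subsetD[OF closure_subset]) simp
    then have "norm x \<le> R" by (rule R(2))
    then show False using that by simp
  qed
  have "frechet_derivative \<phi> (at x) (axis j 1) = 0" if "norm x > R" for x
  proof -
    have "((\<lambda>_. 0) has_derivative (\<lambda>_. 0)) (at x)" by simp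
    then have "(\<phi> has_derivative (\<lambda>_. 0)) (at x)"
      by (rule has_derivative_transform_within_open[where s = "- cball 0 R"])
        (use that 0 in \<open>simp_all add: open_Compl\<close>)
    then have "frechet_derivative \<phi> (at x) = (\<lambda>_. 0)"
      by (rule frechet_derivative_at[symmetric])
    then show ?thesis by simp
  qed
  then show "\<exists>R>0. \<forall>x. norm x > R \<longrightarrow> \<phi> x = 0 \<and> frechet_derivative \<phi> (at x) (axis j 1) = 0"
    using R(1) 0 by blast
qed

lemma L2_loc_of_bounded_on_compacts:
  fixes g M :: "real^2 \<Rightarrow> real"
  assumes g [measurable]: "g \<in> borel_measurable borel"
    and M: "continuous_on UNIV M"
    and bd: "AE x in lborel. \<bar>g x\<bar> \<le> M x"
  shows "L2_loc g"
  unfolding L2_loc_def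
proof (intro conjI allI impI)
  show "g \<in> borel_measurable lebesgue" by (rule measurable_completion) simp
  fix S :: "(real^2) set" assume S: "compact S"
  then have [measurable]: "S \<in> sets borel" by (simp add: borel_compact)
  have "integrable lborel (\<lambda>x. indicator S x *\<^sub>R (M x)\<^sup>2)"
    by (rule borel_integrable_compact[OF S])
      (intro continuous_intros continuous_on_subset[OF M] subset_UNIV)
  then have "integrable lborel (\<lambda>x. indicator S x *\<^sub>R (g x)\<^sup>2)"
  proof (rule Bochner_Integration.integrable_bound)
    show "AE x in lborel. norm (indicator S x *\<^sub>R (g x)\<^sup>2) \<le> norm (indicator S x *\<^sub>R (M x)\<^sup>2)"
      using bd
    proof eventually_elim
      case (elim x)
      have "(g x)\<^sup>2 \<le> (M x)\<^sup>2" using power_mono[OF elim, of 2] by simp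
      then show ?case by (simp add: indicator_def)
    qed
  qed measurable
  then show "set_integrable lebesgue S (\<lambda>x. (g x)\<^sup>2)"
    unfolding set_integrable_def by (subst integrable_completion) simp_all
qed

text \<open>By the product rule the weak derivative identity says that the derivative of
  \<open>f x $ i * \<phi> x\<close> in a coordinate direction has integral 0, which is a statement
  about limits of difference quotients. Their uniform bound comes from \<open>lines\<close>: almost
  every line in a coordinate direction meets \<open>Z\<close> finitely often, and continuity across
  these points rules out a singular part of the derivative.\<close>

lemma weak_derivative_of_derivative_off_null_set:
  fixes f :: "real^2 \<Rightarrow> real^2" and M :: "real^2 \<Rightarrow> real"
  assumes cont: "continuous_on UNIV f"
    and der: "\<And>x. x \<notin> Z \<Longrightarrow> (f has_derivative L x) (at x)"
    and bd: "\<And>x v. x \<notin> Z \<Longrightarrow> norm (L x v) \<le> M x * norm v"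
    and M: "continuous_on UNIV M"
    and null: "AE x in lborel. x \<notin> Z"
    and lines: "\<And>j. AE x in lborel. finite {t. x + t *\<^sub>R axis j 1 \<in> Z}"
  obtains D where "W12_loc_with f D" "\<And>x. x \<notin> Z \<Longrightarrow> (*v) (D x) = L x"
proof -
  define q where "q j i n x = (f (x + (1 / Suc n) *\<^sub>R axis j 1) $ i - f x $ i) * Suc n"
    for j i n x
  \<comment> \<open>A limit of continuous quotients is Borel measurable whatever the dependence of
    \<open>L x\<close> on \<open>x\<close>. On \<open>Z\<close>, where the limit may fail to exist,
    the value of \<open>lim\<close> does not matter because \<open>Z\<close> is null.\<close>
  define D :: "real^2 \<Rightarrow> real^2^2" where "D x = (\<chi> i j. lim (\<lambda>n. q j i n x))" for x
  have fm [measurable]: "f \<in> borel_measurable borel"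
    using cont by (rule borel_measurable_continuous_onI)
  have fi: "continuous_on UNIV (\<lambda>x. f x $ i)" for i
    using cont by (intro continuous_intros)
  have fim [measurable]: "(\<lambda>x. f x $ i) \<in> borel_measurable borel" for i
    using fi by (rule borel_measurable_continuous_onI)
  have qm [measurable]: "q j i n \<in> borel_measurable borel" for j i n
  proof -
    have "continuous_on UNIV (q j i n)"
      unfolding q_def
      by (intro continuous_intros continuous_on_compose2[OF fi]) auto
    then show ?thesis by (rule borel_measurable_continuous_onI)
  qed
  have Dm [measurable]: "(\<lambda>x. D x $ i $ j) \<in> borel_measurable borel" for i j
    unfolding D_def by simp measurable
  have seq: "filterlim (\<lambda>n. 1 / real (Suc n)) (at 0) sequentially"
    using lim_1_over_n[THEN LIMSEQ_Suc] by (auto simp: filterlim_at)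
  have line_der: "((\<lambda>t. f (x + t *\<^sub>R axis j 1) $ i) has_vector_derivative
      L (x + s *\<^sub>R axis j 1) (axis j 1) $ i) (at s)"
    if "x + s *\<^sub>R axis j 1 \<notin> Z" for x s j i
  proof -
    have lin: "linear (L (x + s *\<^sub>R axis j 1))"
      using der[OF that] by (rule has_derivative_linear)
    have "((\<lambda>t. f (x + t *\<^sub>R axis j 1)) has_derivative
        (\<lambda>t. L (x + s *\<^sub>R axis j 1) (t *\<^sub>R axis j 1))) (at s)"
      by (rule has_derivative_compose[where f = "\<lambda>t. x + t *\<^sub>R axis j 1" and g = f, OF _ der[OF that]]) (auto intro!: derivative_eq_intros)
    then have "((\<lambda>t. f (x + t *\<^sub>R axis j 1) $ i) has_derivative
        (\<lambda>t. L (x + s *\<^sub>R axis j 1) (t *\<^sub>R axis j 1) $ i)) (at s)"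
      by (rule bounded_linear.has_derivative[OF bounded_linear_vec_nth])
    then show ?thesis
      by (simp add: has_vector_derivative_def linear_cmul[OF lin])
  qed
  have q_lim: "(\<lambda>n. q j i n x) \<longlonglongrightarrow> L x (axis j 1) $ i" if "x \<notin> Z" for x j i
  proof -
    have "((\<lambda>t. f (x + t *\<^sub>R axis j 1) $ i) has_field_derivative L x (axis j 1) $ i) (at 0)"
      using line_der[of x 0 j i] that by (simp add: has_real_derivative_iff_has_vector_derivative)
    then have "((\<lambda>h. (f (x + h *\<^sub>R axis j 1) $ i - f x $ i) / h) \<longlongrightarrow> L x (axis j 1) $ i) (at 0)"
      by (simp add: DERIV_def)
    from filterlim_compose[OF this seq] show ?thesis by (simp add: q_def)
  qed
  have D_entry: "D x $ i $ j = L x (axis j 1) $ i" if "x \<notin> Z" for x i j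
    using q_lim[OF that, of j i] by (simp add: D_def limI)
  have D_L: "(*v) (D x) = L x" if "x \<notin> Z" for x
  proof -
    have "D x = matrix (L x)" by (simp add: vec_eq_iff D_entry[OF that] matrix_def)
    then show ?thesis
      using matrix_vector_mul[of "L x"] has_derivative_linear[OF der[OF that]]
      by (simp add: linear_matrix_vector_mul_eq)
  qed
  have D_bd: "\<bar>D x $ i $ j\<bar> \<le> M x" if "x \<notin> Z" for x i j
    using bd[OF that, of "axis j 1"] component_le_norm_cart[of "L x (axis j 1)" i]
    by (simp add: D_entry[OF that] norm_axis_1)
  have "L2_loc (\<lambda>x. f x $ i)" for i
    by (rule L2_loc_of_bounded_on_compacts[OF fim, where M = "\<lambda>x. \<bar>f x $ i\<bar>"])
      (auto intro!: continuous_intros fi)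
  moreover have "L2_loc (\<lambda>x. D x $ i $ j)" for i j
    by (rule L2_loc_of_bounded_on_compacts[OF Dm M])
      (use null in eventually_elim, rule D_bd)
  moreover have "weak_derivative f D"
    unfolding weak_derivative_def
  proof (intro allI impI)
    fix i j :: 2 and \<phi> :: "real^2 \<Rightarrow> real"
    assume \<phi>: "test_function \<phi>"
    define e where "e = (axis j 1 :: real^2)"
    define \<psi> where "\<psi> x = frechet_derivative \<phi> (at x) e" for x
    have \<phi>c: "continuous_on UNIV \<phi>" and \<psi>c: "continuous_on UNIV \<psi>"
      unfolding \<psi>_def e_def using test_functionD[OF \<phi>] by auto
    have [measurable]: "\<phi> \<in> borel_measurable borel" "\<psi> \<in> borel_measurable borel"
      using \<phi>c \<psi>c by (auto intro: borel_measurable_continuous_onI)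
    obtain R where R: "R > 0" "\<And>x. norm x > R \<Longrightarrow> \<phi> x = 0" "\<And>x. norm x > R \<Longrightarrow> \<psi> x = 0"
      unfolding \<psi>_def e_def using test_functionD(4)[OF \<phi>, of j] by blast
    define g where "g x = f x $ i * \<phi> x" for x
    define d where "d x = D x $ i $ j * \<phi> x + f x $ i * \<psi> x" for x
    have gc: "continuous_on UNIV g"
      unfolding g_def by (intro continuous_intros fi \<phi>c)
    \<comment> \<open>A continuous majorant of \<open>\<bar>d x\<bar>\<close> off \<open>Z\<close>,
      so that compactness of the ball yields a constant; \<open>d\<close> itself may be
      discontinuous.\<close>
    define b where "b x = M x * \<bar>\<phi> x\<bar> + \<bar>f x $ i\<bar> * \<bar>\<psi> x\<bar>" for x
    have "continuous_on UNIV b"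
      unfolding b_def by (intro continuous_intros fi \<phi>c \<psi>c M)
    then have "continuous_on (cball 0 R) b"
      by (rule continuous_on_subset) simp
    then have "bounded (b ` cball 0 R)"
      by (rule compact_imp_bounded[OF compact_continuous_image[OF _ compact_cball]])
    then obtain B where B: "B > 0" "\<And>x. norm x \<le> R \<Longrightarrow> \<bar>b x\<bar> \<le> B"
      by (auto simp: bounded_pos)
    have dB: "\<bar>d x\<bar> \<le> B" if "x \<notin> Z" for x
    proof (cases "norm x \<le> R")
      case True
      have "\<bar>d x\<bar> \<le> b x"
        unfolding d_def b_def
        by (rule order_trans[OF abs_triangle_ineq])
          (auto simp: abs_mult intro!: mult_right_mono D_bd that)
      then show ?thesis using B(2)[OF True] by linarith
    next
      case False
      then show ?thesis using R B(1) by (simp add: d_def)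
    qed
    have g_der: "((\<lambda>t. g (x + t *\<^sub>R e)) has_vector_derivative d (x + s *\<^sub>R e)) (at s)"
      if "x + s *\<^sub>R e \<notin> Z" for x s
    proof -
      have "((\<lambda>t. \<phi> (x + t *\<^sub>R e)) has_derivative
          (\<lambda>t. frechet_derivative \<phi> (at (x + s *\<^sub>R e)) (t *\<^sub>R e))) (at s)"
        by (rule has_derivative_compose[where f = "\<lambda>t. x + t *\<^sub>R e" and g = \<phi>, OF _ test_functionD(2)[OF \<phi>]])
          (auto intro!: derivative_eq_intros)
      then have p: "((\<lambda>t. \<phi> (x + t *\<^sub>R e)) has_vector_derivative \<psi> (x + s *\<^sub>R e)) (at s)"
        using linear_cmul[OF has_derivative_linear[OF test_functionD(2)[OF \<phi>]]]
        by (simp add: has_vector_derivative_def \<psi>_def)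
      have "((\<lambda>t. f (x + t *\<^sub>R e) $ i) has_vector_derivative D (x + s *\<^sub>R e) $ i $ j) (at s)"
        using line_der[of x s j i] that D_entry[OF that] by (simp add: e_def)
      from has_vector_derivative_mult[OF this p] show ?thesis
        by (simp add: g_def d_def algebra_simps)
    qed
    have dm: "d \<in> borel_measurable borel"
      unfolding d_def by measurable
    have lim: "AE x in lborel. (\<lambda>n. (g (x + (1 / Suc n) *\<^sub>R e) - g x) * Suc n) \<longlonglongrightarrow> d x"
      using null
    proof eventually_elim
      case (elim x)
      have "((\<lambda>t. g (x + t *\<^sub>R e)) has_field_derivative d x) (at 0)"
        using g_der[of x 0] elim by (simp add: has_real_derivative_iff_has_vector_derivative)
      then have "((\<lambda>h. (g (x + h *\<^sub>R e) - g x) / h) \<longlongrightarrow> d x) (at 0)"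
        by (simp add: DERIV_def)
      from filterlim_compose[OF this seq] show ?case by simp
    qed
    \<comment> \<open>The point \<open>x\<close> itself may lie in \<open>Z\<close>; what matters is
      that its line meets \<open>Z\<close> finitely often, so that the mean value inequality applies
      along the segment.\<close>
    have bound: "AE x in lborel. \<bar>(g (x + (1 / Suc n) *\<^sub>R e) - g x) * Suc n\<bar> \<le> B" for n
      using lines[of j]
    proof eventually_elim
      case (elim x)
      have "norm (g (x + (1 / Suc n) *\<^sub>R e) - g (x + 0 *\<^sub>R e)) \<le> B * (1 / Suc n)"
      proof (rule norm_diff_le_of_derivative_bound_off_finite
          [where h = "\<lambda>t. g (x + t *\<^sub>R e)" and h' = "\<lambda>t. d (x + t *\<^sub>R e)"
            and S = "{t. x + t *\<^sub>R e \<in> Z}"])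
        show "finite {t. x + t *\<^sub>R e \<in> Z}" using elim by (simp add: e_def)
        show "continuous_on {0..1 / real (Suc n)} (\<lambda>t. g (x + t *\<^sub>R e))"
          by (rule continuous_on_compose2[OF gc]) (auto intro!: continuous_intros)
        show "((\<lambda>t. g (x + t *\<^sub>R e)) has_vector_derivative d (x + t *\<^sub>R e)) (at t)"
          if "t \<notin> {t. x + t *\<^sub>R e \<in> Z}" for t
          using g_der that by blast
        show "norm (d (x + t *\<^sub>R e)) \<le> B" if "t \<notin> {t. x + t *\<^sub>R e \<in> Z}" for t
          using dB that by simp
        show "0 \<le> 1 / real (Suc n)" by simp
        show "0 \<le> B" using B by simp
      qed
      then show ?case
        unfolding abs_mult by (simp add: pos_le_divide_eq del: of_nat_Suc)
    qed
    have g0: "g x = 0" if "norm x > R" for x using R(2)[OF that] by (simp add: g_def)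
    have e1: "norm e \<le> 1" by (simp add: e_def norm_axis_1)
    note d0 = integral_lim_difference_quotient_eq_0[OF gc g0 e1 dm lim bound]
    have i1: "integrable lborel (\<lambda>x. f x $ i * \<psi> x)"
    proof -
      have "integrable lborel (\<lambda>x. indicator (cball 0 R) x *\<^sub>R (f x $ i * \<psi> x))"
        by (rule borel_integrable_compact)
          (auto intro!: continuous_intros continuous_on_subset[OF fi] continuous_on_subset[OF \<psi>c])
      moreover have "(\<lambda>x. indicator (cball 0 R) x *\<^sub>R (f x $ i * \<psi> x)) = (\<lambda>x. f x $ i * \<psi> x)"
        using R(3) by (force simp: indicator_def fun_eq_iff not_le)
      ultimately show ?thesis by metis
    qed
    have "integrable lborel (\<lambda>x. d x - f x $ i * \<psi> x)"
      by (rule Bochner_Integration.integrable_diff[OF d0(1) i1])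
    then have i2: "integrable lborel (\<lambda>x. D x $ i $ j * \<phi> x)" by (simp add: d_def)
    have "(LINT x|lborel. D x $ i $ j * \<phi> x) + (LINT x|lborel. f x $ i * \<psi> x) = 0"
      using d0(2) unfolding d_def by (simp add: Bochner_Integration.integral_add[OF i2 i1])
    then have "(LINT x|lborel. f x $ i * \<psi> x) = - (LINT x|lborel. D x $ i $ j * \<phi> x)" by simp
    moreover have "(LINT x|lebesgue. f x $ i * \<psi> x) = (LINT x|lborel. f x $ i * \<psi> x)"
      by (rule integral_completion) measurable
    moreover have "(LINT x|lebesgue. D x $ i $ j * \<phi> x) = (LINT x|lborel. D x $ i $ j * \<phi> x)"
      by (rule integral_completion) measurable
    ultimately show "(LINT x|lebesgue. f x $ i * frechet_derivative \<phi> (at x) (axis j 1))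
       = - (LINT x|lebesgue. D x $ i $ j * \<phi> x)"
      by (simp add: \<psi>_def e_def)
  qed
  ultimately have "W12_loc_with f D" by (simp add: W12_loc_with_def)
  then show thesis using that D_L by blast
qed

section \<open>Distortion of real-linear maps\<close>

definition complex_of_vec2 :: "real^2 \<Rightarrow> complex" where
  "complex_of_vec2 x = Complex (x $ 1) (x $ 2)"

definition vec2_of_complex :: "complex \<Rightarrow> real^2" where
  "vec2_of_complex z = (\<chi> i. if i = 1 then Re z else Im z)"

lemma vec2_of_complex_nth [simp]:
  "vec2_of_complex z $ 1 = Re z" "vec2_of_complex z $ 2 = Im z"
  by (simp_all add: vec2_of_complex_def)

lemma complex_of_vec2_sel [simp]:
  "Re (complex_of_vec2 x) = x $ 1" "Im (complex_of_vec2 x) = x $ 2"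
  by (simp_all add: complex_of_vec2_def)

lemma complex_of_vec2_inverse [simp]:
  "complex_of_vec2 (vec2_of_complex z) = z" "vec2_of_complex (complex_of_vec2 x) = x"
  by (simp_all add: complex_eq_iff vec_eq_iff forall_2)

lemma norm_vec2: "norm (x :: real^2) = sqrt ((x $ 1)\<^sup>2 + (x $ 2)\<^sup>2)"
  by (simp add: norm_vec_def L2_set_def sum_2)

lemma norm_complex_of_vec2 [simp]: "norm (complex_of_vec2 x) = norm x"
  by (simp add: norm_vec2 cmod_def)

lemma norm_vec2_of_complex [simp]: "norm (vec2_of_complex z) = norm z"
  by (simp add: norm_vec2 cmod_def)

lemma bounded_linear_complex_of_vec2: "bounded_linear complex_of_vec2"
  by (rule bounded_linear_intro[where K = 1]) (simp_all add: complex_eq_iff)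

lemma bounded_linear_vec2_of_complex: "bounded_linear vec2_of_complex"
  by (rule bounded_linear_intro[where K = 1]) (simp_all add: vec_eq_iff forall_2)

definition jac :: "(complex \<Rightarrow> complex) \<Rightarrow> real" where
  "jac L = Re (L 1) * Im (L \<i>) - Im (L 1) * Re (L \<i>)"

text \<open>Stated for each vector instead of through the operator norm, so that the constants of a
  composition multiply by chaining two inequalities.\<close>

definition distortion_le :: "real \<Rightarrow> (complex \<Rightarrow> complex) \<Rightarrow> bool" where
  "distortion_le K L \<longleftrightarrow> linear L \<and> (\<forall>v. (cmod (L v))\<^sup>2 \<le> K * jac L * (cmod v)\<^sup>2)"

lemma linear_complex_eq:
  assumes "linear (L :: complex \<Rightarrow> complex)"
  shows "L v = of_real (Re v) * L 1 + of_real (Im v) * L \<i>"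
proof -
  have "v = Re v *\<^sub>R 1 + Im v *\<^sub>R \<i>" by (simp add: complex_eq_iff)
  then have "L v = L (Re v *\<^sub>R 1 + Im v *\<^sub>R \<i>)" by metis
  also have "\<dots> = Re v *\<^sub>R L 1 + Im v *\<^sub>R L \<i>"
    by (simp only: linear_add[OF assms] linear_cmul[OF assms])
  finally show ?thesis by (simp only: scaleR_conv_of_real)
qed

lemma jacobian_compose:
  assumes "linear L1"
  shows "jac (\<lambda>v. L1 (L2 v)) = jac L1 * jac L2"
  by (simp add: jac_def linear_complex_eq[OF assms, of "L2 1"]
      linear_complex_eq[OF assms, of "L2 \<i>"] algebra_simps)

lemma distortion_leD:
  assumes "distortion_le K L"
  shows "linear L" and "(cmod (L v))\<^sup>2 \<le> K * jac L * (cmod v)\<^sup>2"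
  using assms by (simp_all only: distortion_le_def)

lemma distortion_le_jacobian_nonneg:
  assumes "distortion_le K L"
  shows "0 \<le> K * jac L"
  using order_trans[OF zero_le_power2 distortion_leD(2)[OF assms, of 1]] by simp

lemma distortion_le_compose:
  assumes 1: "distortion_le K1 L1" and 2: "distortion_le K2 L2"
  shows "distortion_le (K1 * K2) (\<lambda>v. L1 (L2 v))"
proof -
  have "linear (\<lambda>v. L1 (L2 v))"
    using linear_compose[OF distortion_leD(1)[OF 2] distortion_leD(1)[OF 1]] by (simp add: o_def)
  moreover have "(cmod (L1 (L2 v)))\<^sup>2 \<le> K1 * K2 * jac (\<lambda>v. L1 (L2 v)) * (cmod v)\<^sup>2" for v
  proof -
    have "(cmod (L1 (L2 v)))\<^sup>2 \<le> K1 * jac L1 * (cmod (L2 v))\<^sup>2"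
      by (rule distortion_leD(2)[OF 1])
    also have "\<dots> \<le> K1 * jac L1 * (K2 * jac L2 * (cmod v)\<^sup>2)"
      by (rule mult_left_mono[OF distortion_leD(2)[OF 2] distortion_le_jacobian_nonneg[OF 1]])
    also have "\<dots> = K1 * K2 * jac (\<lambda>v. L1 (L2 v)) * (cmod v)\<^sup>2"
      using jacobian_compose[OF distortion_leD(1)[OF 1], of L2] by simp
    finally show ?thesis .
  qed
  ultimately show ?thesis unfolding distortion_le_def by blast
qed

lemma distortion_le_mult: "distortion_le 1 ((*) a)"
proof -
  have "linear ((*) a)" by (rule linear_times)
  moreover have "jac ((*) a) = (cmod a)\<^sup>2"
    unfolding jac_def cmod_power2 by (simp add: power2_eq_square)
  ultimately show ?thesis
    by (simp add: distortion_le_def norm_mult power_mult_distrib)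
qed

lemma distortion_le_mult_right: "distortion_le 1 (\<lambda>v. v * a)"
  using distortion_le_mult[of a] by (simp add: mult.commute[of _ a])

text \<open>Conjugation by the reflection \<open>- cnj v\<close> reverses orientation twice, so the
  Jacobian is unchanged, and the reflection is an isometry.\<close>

lemma distortion_le_reflect:
  assumes "distortion_le K L"
  shows "distortion_le K (\<lambda>v. - cnj (L (- cnj v)))"
proof -
  have lin: "linear L" using assms by (simp add: distortion_le_def)
  have "jac (\<lambda>v. - cnj (L (- cnj v))) = jac L"
    by (simp add: jac_def linear_neg[OF lin])
  moreover have "linear (\<lambda>v. - cnj (L (- cnj v)))"
    by (intro linearI) (simp_all add: linear_add[OF lin] linear_diff[OF lin] linear_neg[OF lin] linear_cmul[OF lin])
  moreover have "(cmod (L (- cnj v)))\<^sup>2 \<le> K * jac L * (cmod (- cnj v))\<^sup>2" for v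
    using assms unfolding distortion_le_def by blast
  ultimately show ?thesis
    by (simp add: distortion_le_def)
qed

text \<open>The line \<open>Re z = 0\<close> is meant as the seam of a reflection and
  \<open>P\<close> as a set of isolated bad points. The continuous bound \<open>M\<close> makes the
  derivative locally bounded, hence locally square integrable.\<close>

lemma quasiregular_of_complex:
  fixes F :: "complex \<Rightarrow> complex" and M :: "complex \<Rightarrow> real"
  assumes cont: "continuous_on UNIV F"
    and P: "finite P"
    and der: "\<And>z. Re z \<noteq> 0 \<Longrightarrow> z \<notin> P \<Longrightarrow> (F has_derivative L z) (at z)"
    and K: "K \<ge> 1" "\<And>z. Re z \<noteq> 0 \<Longrightarrow> z \<notin> P \<Longrightarrow> distortion_le K (L z)"
    and bd: "\<And>z v. Re z \<noteq> 0 \<Longrightarrow> z \<notin> P \<Longrightarrow> cmod (L z v) \<le> M z * cmod v"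
    and M: "continuous_on UNIV M"
  shows "quasiregular (\<lambda>x. vec2_of_complex (F (complex_of_vec2 x)))"
proof -
  let ?f = "\<lambda>x. vec2_of_complex (F (complex_of_vec2 x))"
  let ?L = "\<lambda>x v. vec2_of_complex (L (complex_of_vec2 x) (complex_of_vec2 v))"
  define Z where "Z = {x :: real^2. x $ 1 = 0} \<union> vec2_of_complex ` P"
  have Z: "Re (complex_of_vec2 x) \<noteq> 0" "complex_of_vec2 x \<notin> P" if "x \<notin> Z" for x
    using that imageI[of "complex_of_vec2 x" P vec2_of_complex] by (auto simp: Z_def)
  have fcont: "continuous_on UNIV ?f"
    by (intro bounded_linear.continuous_on[OF bounded_linear_vec2_of_complex]
        continuous_on_compose2[OF cont] linear_continuous_on bounded_linear_complex_of_vec2) auto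
  have fder: "(?f has_derivative ?L x) (at x)" if "x \<notin> Z" for x
    by (intro bounded_linear.has_derivative[OF bounded_linear_vec2_of_complex])
      (rule has_derivative_compose[where f = complex_of_vec2,
          OF bounded_linear_imp_has_derivative[OF bounded_linear_complex_of_vec2] der[OF Z[OF that]]])
  have fbd: "norm (?L x v) \<le> M (complex_of_vec2 x) * norm v" if "x \<notin> Z" for x v
    using bd[OF Z[OF that], of "complex_of_vec2 v"] by simp
  have Mc: "continuous_on UNIV (\<lambda>x. M (complex_of_vec2 x))"
    by (intro continuous_on_compose2[OF M] linear_continuous_on bounded_linear_complex_of_vec2) auto
  have "negligible Z"
    unfolding Z_def using P
    by (intro negligible_Un negligible_standard_hyperplane_cart negligible_finite) auto
  then have null': "AE x in lebesgue. x \<notin> Z"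
    unfolding negligible_iff_null_sets by (rule AE_not_in)
  then have null: "AE x in lborel. x \<notin> Z"
    by (simp only: AE_completion_iff)
  have lines: "AE x in lborel. finite {t. x + t *\<^sub>R axis j 1 \<in> Z}" for j :: 2
    using null
  proof eventually_elim
    case (elim x)
    have inj: "inj (\<lambda>t. x + t *\<^sub>R (axis j 1 :: real^2))"
      by (rule injI) (simp add: axis_eq_0_iff)
    \<comment> \<open>A horizontal line meets the imaginary axis once; a vertical line through
      \<open>x\<close> misses it, because \<open>x\<close> is off the axis.\<close>
    have "x $ 1 \<noteq> 0" using elim by (simp add: Z_def)
    then have "{t. (x + t *\<^sub>R axis j 1) $ 1 = 0} \<subseteq> {- x $ 1}"
      by (auto simp: axis_def)
    then have "finite {t. (x + t *\<^sub>R axis j 1) $ 1 = 0}"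
      by (rule finite_subset) simp
    moreover
    have "finite ((\<lambda>t. x + t *\<^sub>R axis j 1) -` (vec2_of_complex ` P))"
      by (rule finite_vimageI[OF _ inj]) (use P in simp)
    moreover have "{t. x + t *\<^sub>R axis j 1 \<in> Z} = {t. (x + t *\<^sub>R axis j 1) $ 1 = 0} \<union>
        (\<lambda>t. x + t *\<^sub>R axis j 1) -` (vec2_of_complex ` P)"
      unfolding Z_def by blast
    ultimately show ?case by simp
  qed
  obtain D where D: "W12_loc_with ?f D" and DL: "\<And>x. x \<notin> Z \<Longrightarrow> (*v) (D x) = ?L x"
    using weak_derivative_of_derivative_off_null_set[OF fcont fder fbd Mc null lines] by blast
  have "AE x in lebesgue. (onorm ((*v) (D x)))\<^sup>2 \<le> K * det (D x)"
    using null'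
  proof eventually_elim
    case (elim x)
    let ?J = "jac (L (complex_of_vec2 x))"
    note dist = K(2)[OF Z[OF elim]]
    have J0: "0 \<le> K * ?J" by (rule distortion_le_jacobian_nonneg[OF dist])
    have col: "D x $ i $ j = ?L x (axis j 1) $ i" for i j
    proof -
      have "column j (D x) = ?L x (axis j 1)"
        using fun_cong[OF DL[OF elim], of "axis j 1"] by (simp only: matrix_vector_mult_basis)
      from arg_cong[OF this, of "\<lambda>u. u $ i"] show ?thesis
        by (simp add: column_def)
    qed
    have e: "complex_of_vec2 (axis 1 1) = 1" "complex_of_vec2 (axis 2 1) = \<i>"
      by (simp_all add: complex_eq_iff axis_def)
    have det: "det (D x) = ?J"
      by (simp add: det_2 col e jac_def)
    have "norm ((*v) (D x) v) \<le> sqrt (K * ?J) * norm v" for v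
    proof -
      have "(cmod (L (complex_of_vec2 x) (complex_of_vec2 v)))\<^sup>2
          \<le> K * ?J * (cmod (complex_of_vec2 v))\<^sup>2"
        using dist unfolding distortion_le_def by blast
      then have "(norm ((*v) (D x) v))\<^sup>2 \<le> K * ?J * (norm v)\<^sup>2"
        by (simp add: DL[OF elim])
      from real_le_rsqrt[OF this] show ?thesis
        by (simp add: real_sqrt_mult)
    qed
    then have "onorm ((*v) (D x)) \<le> sqrt (K * ?J)"
      by (intro onorm_bound) (use J0 in auto)
    then have "(onorm ((*v) (D x)))\<^sup>2 \<le> (sqrt (K * ?J))\<^sup>2"
      by (intro power_mono onorm_pos_le) auto
    then show ?case using J0 det by simp
  qed
  then show ?thesis
    unfolding quasiregular_def using fcont D K(1) by blast
qed

section \<open>The disc map\<close>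

lemma distortion_le_mono:
  assumes "distortion_le K L" "K \<le> K'" "0 < K"
  shows "distortion_le K' L"
proof -
  have J: "0 \<le> jac L"
    using distortion_le_jacobian_nonneg[OF assms(1)] \<open>0 < K\<close> by (simp add: zero_le_mult_iff)
  have "(cmod (L v))\<^sup>2 \<le> K' * jac L * (cmod v)\<^sup>2" for v
    by (rule order_trans[OF distortion_leD(2)[OF assms(1)]])
      (intro mult_right_mono assms J zero_le_power2)
  then show ?thesis
    using distortion_leD(1)[OF assms(1)] unfolding distortion_le_def by blast
qed

lemma distortion_leI:
  assumes "linear L" "0 < j" "j \<le> jac L" "\<And>v. cmod (L v) \<le> N * cmod v"
  shows "distortion_le (N\<^sup>2 / j) L"
proof -
  have "(cmod (L v))\<^sup>2 \<le> N\<^sup>2 / j * jac L * (cmod v)\<^sup>2" for v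
  proof -
    have "(cmod (L v))\<^sup>2 \<le> (N * cmod v)\<^sup>2"
      using assms(4) by (intro power_mono) auto
    also have "\<dots> = N\<^sup>2 / j * j * (cmod v)\<^sup>2"
      using \<open>0 < j\<close> by (simp add: power_mult_distrib)
    also have "\<dots> \<le> N\<^sup>2 / j * jac L * (cmod v)\<^sup>2"
      using assms(2,3) by (intro mult_right_mono mult_left_mono) auto
    finally show ?thesis .
  qed
  then show ?thesis using assms(1) unfolding distortion_le_def by blast
qed

text \<open>Under the radius map \<open>6 * r / (5 + r)\<close> the quantity
  \<open>ln (r / (1 - r))\<close> grows by \<open>ln (6/5)\<close>, and the squared cosine has
  period \<open>pi\<close>, so this function is constant along orbits of radii. For
  \<open>0 < r < 1\<close> it equals 1 exactly when \<open>r / (1 - r)\<close> is an integer power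
  of 6/5.\<close>

definition phase :: "real \<Rightarrow> real" where
  "phase r = (cos (pi * ln (r / (1 - r)) / ln (6/5)))\<^sup>2"

text \<open>Since \<open>1 - cmod w \<le> cmod (1 - w)\<close>, with equality only on the segment
  from 0 to 1, the angle is nonnegative in the disc. For \<open>0 < cmod w < 1\<close> it vanishes
  only on that segment at radii of phase 1. The factor 1/2 limits backward rotation of circles, so
  that the Jacobian stays positive, and keeps the unit circle minus 1 away from 1.\<close>

definition twist_angle :: "complex \<Rightarrow> real" where
  "twist_angle w = (cmod (1 - w) - (1 - cmod w) * phase (cmod w)) / 2"

definition disc_map :: "complex \<Rightarrow> complex" where
  "disc_map w = of_real (6 / (5 + cmod w)) * cis (twist_angle w) * w"

lemma phase_bounds: "0 \<le> phase r" "phase r \<le> 1"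
  by (simp_all add: phase_def abs_square_le_1)

lemma phase_step:
  assumes "0 < r" "r < 1"
  shows "phase (6 * r / (5 + r)) = phase r"
proof -
  have "1 - 6 * r / (5 + r) = 5 * (1 - r) / (5 + r)"
    using assms by (simp add: field_simps)
  then have "6 * r / (5 + r) / (1 - 6 * r / (5 + r)) = 6 / 5 * (r / (1 - r))"
    using assms by simp
  then have "ln (6 * r / (5 + r) / (1 - 6 * r / (5 + r))) = ln (6/5) + ln (r / (1 - r))"
    using ln_mult[of "6/5" "r / (1 - r)"] assms by simp
  moreover have "ln (6/5 :: real) \<noteq> 0" by simp
  ultimately have "pi * ln (6 * r / (5 + r) / (1 - 6 * r / (5 + r))) / ln (6/5)
      = pi * ln (r / (1 - r)) / ln (6/5) + pi"
    by (simp add: field_simps)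
  then show ?thesis by (simp add: phase_def)
qed

lemma cmod_disc_map: "cmod (disc_map w) = 6 * cmod w / (5 + cmod w)"
  by (simp add: disc_map_def norm_mult del: of_real_add of_real_divide)

lemma cmod_disc_map_le: "cmod (disc_map w) \<le> 6/5 * cmod w"
proof -
  have "6 * cmod w / (5 + cmod w) \<le> 6 * cmod w / 5"
    by (rule divide_left_mono) (auto intro: add_pos_nonneg)
  then show ?thesis by (simp add: cmod_disc_map)
qed

lemma one_minus_cmod_disc_map:
  "1 - cmod (disc_map w) = 5 * (1 - cmod w) / (5 + cmod w)"
  unfolding cmod_disc_map by (simp add: field_simps add_nonneg_eq_0_iff)

lemma cmod_disc_map_less_1: "cmod w < 1 \<Longrightarrow> cmod (disc_map w) < 1"
  using add_pos_nonneg[of 5 "cmod w"]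
  unfolding cmod_disc_map by (simp add: pos_divide_less_eq)

lemma disc_map_eq_0_iff [simp]: "disc_map w = 0 \<longleftrightarrow> w = 0"
proof -
  have "cmod (disc_map w) = 0 \<longleftrightarrow> cmod w = 0"
    unfolding cmod_disc_map using norm_ge_zero[of w] by (simp add: add_nonneg_eq_0_iff)
  then show ?thesis by simp
qed

lemma twist_angle_bounds:
  assumes "cmod w \<le> 1"
  shows "0 \<le> twist_angle w" "twist_angle w \<le> cmod (1 - w) / 2"
    and "phase (cmod w) \<le> 1/2 \<Longrightarrow> cmod (1 - w) / 4 \<le> twist_angle w"
proof -
  have 1: "1 - cmod w \<le> cmod (1 - w)"
    using norm_triangle_ineq2[of 1 w] by simp
  have le: "(1 - cmod w) * phase (cmod w) \<le> (1 - cmod w) * 1"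
    using assms phase_bounds by (intro mult_left_mono) auto
  then show "0 \<le> twist_angle w" using 1 by (simp add: twist_angle_def)
  show "twist_angle w \<le> cmod (1 - w) / 2"
    using assms phase_bounds by (simp add: twist_angle_def)
  assume "phase (cmod w) \<le> 1/2"
  then have "(1 - cmod w) * phase (cmod w) \<le> (1 - cmod w) * (1/2)"
    using assms by (intro mult_left_mono) auto
  then show "cmod (1 - w) / 4 \<le> twist_angle w" using 1 by (simp add: twist_angle_def)
qed

lemma norm_cis_minus_1_le: "cmod (1 - cis t) \<le> \<bar>t\<bar>"
  using dist_exp_i_1[of t] abs_sin_x_le_abs_x[of "t / 2"]
  by (simp add: cis_conv_exp norm_minus_commute)

text \<open>A preimage of 1 lies on the unit circle, where the rotation angle is half the chord from
  \<open>w\<close> to 1; but the angle needed to reach 1 is at least the whole chord. Hence the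
  Cayley transform of the image is finite.\<close>

lemma disc_map_neq_1:
  assumes "cmod w \<le> 1" "w \<noteq> 1"
  shows "disc_map w \<noteq> 1"
proof
  assume eq: "disc_map w = 1"
  then have "6 * cmod w / (5 + cmod w) = 1" using cmod_disc_map[of w] by simp
  then have r: "cmod w = 1" by (simp add: field_simps split: if_splits)
  then have ta: "twist_angle w = cmod (1 - w) / 2" by (simp add: twist_angle_def)
  have "cis (twist_angle w) * w = 1" using eq r by (simp add: disc_map_def)
  then have "w = cis (- twist_angle w)"
    by (metis cis_inverse inverse_unique)
  then have "cmod (1 - w) \<le> \<bar>- twist_angle w\<bar>"
    using norm_cis_minus_1_le by metis
  then show False using ta assms(2) by simp
qed

lemma phase_continuous: "0 < r \<Longrightarrow> r < 1 \<Longrightarrow> isCont phase r"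
  unfolding phase_def by (intro continuous_intros) auto

text \<open>The phase has no limit as the radius tends to 1, but the factor
  \<open>1 - cmod w\<close> damps its oscillation. At the centre nothing damps it, so
  \<open>w = 0\<close> is excluded here; in \<open>disc_map\<close> the factor \<open>w\<close> does
  the damping.\<close>

lemma twist_angle_continuous:
  assumes "w \<noteq> 0" "cmod w \<le> 1"
  shows "continuous (at w within cball 0 1) twist_angle"
proof -
  have "continuous (at w within cball 0 1) (\<lambda>w. (1 - cmod w) * phase (cmod w))"
  proof (cases "cmod w < 1")
    case True
    have "isCont (\<lambda>w. (1 - cmod w) * phase (cmod w)) w"
      using assms(1) True
      by (intro continuous_intros isCont_o2[where f = cmod, OF _ phase_continuous]) auto
    then show ?thesis by (rule continuous_at_imp_continuous_within)
  next
    case False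
    then have r: "cmod w = 1" using assms by simp
    have lim: "((\<lambda>w. \<bar>1 - cmod w\<bar>) \<longlongrightarrow> 0) (at w within cball 0 1)"
      by (rule tendsto_eq_intros refl | simp add: r)+
    have "((\<lambda>w. (1 - cmod w) * phase (cmod w)) \<longlongrightarrow> 0) (at w within cball 0 1)"
      by (rule Lim_null_comparison[OF always_eventually lim])
        (use phase_bounds in \<open>auto simp: abs_mult mult_left_le\<close>)
    then show ?thesis by (simp add: continuous_within r)
  qed
  then show ?thesis
    unfolding twist_angle_def by (intro continuous_divide continuous_diff) (auto intro!: continuous_intros)
qed

lemma disc_map_continuous: "continuous_on (cball 0 1) disc_map"
  unfolding continuous_on_eq_continuous_within
proof
  fix w :: complex assume w: "w \<in> cball 0 1"
  show "continuous (at w within cball 0 1) disc_map"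
  proof (cases "w = 0")
    case True
    have "(disc_map \<longlongrightarrow> 0) (at 0 within cball 0 1)"
    proof (rule Lim_null_comparison)
      show "\<forall>\<^sub>F w in at 0 within cball 0 1. cmod (disc_map w) \<le> 6/5 * cmod w"
        by (intro always_eventually allI cmod_disc_map_le)
      show "((\<lambda>w. 6/5 * cmod w) \<longlongrightarrow> 0) (at 0 within cball 0 1)"
        by (auto intro!: tendsto_eq_intros)
    qed
    then show ?thesis by (simp add: continuous_within True disc_map_def)
  next
    case False
    have "5 + cmod w \<noteq> 0" using norm_ge_zero[of w] by linarith
    then show ?thesis
      unfolding disc_map_def cis_conv_exp
      using w False by (intro continuous_intros twist_angle_continuous) auto
  qed
qed

section \<open>Derivative and distortion of the disc map\<close>

definition damp' :: "real \<Rightarrow> real" where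
  "damp' r = - phase r - sin (2 * (pi * ln (r / (1 - r)) / ln (6/5))) * pi / (r * ln (6/5))"

lemma damp_derivative:
  assumes "0 < r" "r < 1"
  shows "((\<lambda>r. (1 - r) * phase r) has_field_derivative damp' r) (at r)"
proof -
  let ?a = "pi * ln (r / (1 - r)) / ln (6/5)"
  have "((\<lambda>r. ln (r / (1 - r))) has_field_derivative 1 / (r * (1 - r))) (at r)"
  proof (rule DERIV_cong)
    show "((\<lambda>r. ln (r / (1 - r))) has_field_derivative
        1 / (r / (1 - r)) * ((1 * (1 - r) - r * (0 - 1)) / ((1 - r) * (1 - r)))) (at r)"
      using assms
      by (intro DERIV_chain'[OF _ DERIV_ln_divide] DERIV_divide DERIV_ident DERIV_diff DERIV_const) auto
  qed (use assms in \<open>simp add: divide_simps\<close>)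
  then have "(phase has_field_derivative 2 * cos ?a * (- sin ?a * (pi * (1 / (r * (1 - r))) / ln (6/5)))) (at r)"
    using assms unfolding phase_def by (auto intro!: derivative_eq_intros simp: mult_ac)
  then have "((\<lambda>r. (1 - r) * phase r) has_field_derivative
     (1 - r) * (2 * cos ?a * (- sin ?a * (pi * (1 / (r * (1 - r))) / ln (6/5)))) + (0 - 1) * phase r) (at r)"
    by (auto intro!: derivative_eq_intros)
  moreover have "(1 - r) * (2 * cos ?a * (- sin ?a * (pi * (1 / (r * (1 - r))) / ln (6/5)))) + (0 - 1) * phase r = damp' r"
  proof -
    have "(1 - r) * (2 * cos a * (- sin a * (pi * (1 / (r * (1 - r))) / l))) + (0 - 1) * p
        = - p - 2 * sin a * cos a * pi / (r * l)" if "l \<noteq> 0" for a l p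
      using assms that by (simp add: divide_simps)
    then show ?thesis by (simp only: damp'_def sin_double) simp
  qed
  ultimately show ?thesis by simp
qed

text \<open>The derivative of \<open>ln (r / (1 - r))\<close> is \<open>1 / (r * (1 - r))\<close>.
  The damping factor \<open>1 - r\<close> cancels the pole at 1, and the factor \<open>r\<close>,
  which logarithmic coordinates supply, cancels the pole at 0.\<close>

lemma damp'_bound:
  assumes "0 < r" "r < 1"
  shows "\<bar>r * damp' r\<bar> \<le> 1 + pi / ln (6/5)"
proof -
  have l: "ln (6/5 :: real) > 0" by simp
  let ?s = "sin (2 * (pi * ln (r / (1 - r)) / ln (6/5)))"
  have "r * damp' r = - (r * phase r) - ?s * (pi / ln (6/5))"
    using assms by (simp add: damp'_def field_simps)
  moreover have "\<bar>r * phase r\<bar> \<le> 1"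
    using assms phase_bounds[of r] by (simp add: abs_mult mult_le_one)
  moreover have "\<bar>?s * (pi / ln (6/5))\<bar> \<le> 1 * (pi / ln (6/5))"
    unfolding abs_mult by (intro mult_mono) auto
  ultimately show ?thesis by linarith
qed


definition twist_angle' :: "complex \<Rightarrow> complex \<Rightarrow> real" where
  "twist_angle' w v = (- (v \<bullet> sgn (1 - w)) - damp' (cmod w) * (v \<bullet> sgn w)) / 2"

lemma twist_angle_has_derivative:
  assumes "w \<noteq> 0" "cmod w < 1"
  shows "(twist_angle has_derivative twist_angle' w) (at w)"
proof -
  have "1 - w \<noteq> 0" using assms(2) by auto
  have "((\<lambda>w. cmod (1 - w)) has_derivative (\<lambda>v. (0 - v) \<bullet> sgn (1 - w))) (at w)"
    by (rule has_derivative_compose[where f = "\<lambda>w. 1 - w" and g = cmod,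
          OF _ has_derivative_norm[OF \<open>1 - w \<noteq> 0\<close>]])
      (intro derivative_intros)
  moreover have "((\<lambda>w. (1 - cmod w) * phase (cmod w)) has_derivative
      (\<lambda>v. damp' (cmod w) * (v \<bullet> sgn w))) (at w)"
    by (rule has_derivative_compose[where f = cmod, OF has_derivative_norm[OF assms(1)]
          damp_derivative[THEN has_field_derivative_imp_has_derivative]])
      (use assms in auto)
  ultimately have "((\<lambda>w. (cmod (1 - w) - (1 - cmod w) * phase (cmod w)) / 2) has_derivative
      (\<lambda>v. ((0 - v) \<bullet> sgn (1 - w) - damp' (cmod w) * (v \<bullet> sgn w)) / 2)) (at w)"
    by (intro bounded_linear.has_derivative[OF bounded_linear_divide] has_derivative_diff)
  then show ?thesis by (simp add: twist_angle_def[abs_def] twist_angle'_def[abs_def])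
qed

text \<open>The derivative of \<open>log \<circ> disc_map \<circ> exp\<close>, which is triangular in the basis \<open>1, \<i>\<close>.\<close>

definition log_derivative :: "complex \<Rightarrow> complex \<Rightarrow> complex" where
  "log_derivative w s =
     s - of_real (cmod w * Re s / (5 + cmod w)) + \<i> * of_real (twist_angle' w (w * s))"

lemma inner_mult_sgn: "(w * s) \<bullet> sgn w = cmod w * Re s"
proof -
  have "(w * s) \<bullet> w = (cmod w)\<^sup>2 * Re s"
    unfolding cmod_power2 by (simp add: inner_complex_def power2_eq_square algebra_simps)
  then show ?thesis
    by (cases "w = 0") (simp_all add: sgn_div_norm power2_eq_square)
qed

text \<open>The factored form isolates the distortion: multiplication by \<open>inverse w\<close>
  and by \<open>disc_map w\<close> is conformal, so only \<open>log_derivative\<close> has to be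
  estimated.\<close>

lemma disc_map_has_derivative:
  assumes "w \<noteq> 0" "cmod w < 1"
  shows "(disc_map has_derivative (\<lambda>v. disc_map w * log_derivative w (v * inverse w))) (at w)"
proof -
  let ?r = "cmod w"
  have r: "0 < ?r" "5 + ?r \<noteq> 0" using assms(1) by (auto simp: add_nonneg_eq_0_iff)
  have 1: "((\<lambda>w. 6 / (5 + cmod w)) has_derivative
     (\<lambda>v. - (6 * (v \<bullet> sgn w)) / (5 + ?r)\<^sup>2)) (at w)"
    by (rule has_derivative_compose[where f = cmod and g = "\<lambda>r. 6 / (5 + r)"
          and g' = "\<lambda>h. - (6 * h) / (5 + ?r)\<^sup>2", OF has_derivative_norm[OF assms(1)]])
      (use r in \<open>auto intro!: derivative_eq_intros simp: power2_eq_square field_simps\<close>)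
  have 2: "((\<lambda>w. cis (twist_angle w)) has_derivative
     (\<lambda>v. of_real (twist_angle' w v) * (\<i> * cis (twist_angle w)))) (at w)"
    by (rule has_derivative_compose[OF twist_angle_has_derivative[OF assms]])
      (auto intro!: derivative_eq_intros simp: scaleR_conv_of_real)
  have "((\<lambda>w. of_real (6 / (5 + cmod w)) * cis (twist_angle w) * w) has_derivative
     (\<lambda>v. of_real (6 / (5 + ?r)) * cis (twist_angle w) * v +
       (of_real (6 / (5 + ?r)) * (of_real (twist_angle' w v) * (\<i> * cis (twist_angle w))) +
        of_real (- (6 * (v \<bullet> sgn w)) / (5 + ?r)\<^sup>2) * cis (twist_angle w)) * w)) (at w)"
    by (intro has_derivative_mult has_derivative_of_real 1 2 has_derivative_ident)
  moreover have "of_real (6 / (5 + ?r)) * cis (twist_angle w) * v +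
       (of_real (6 / (5 + ?r)) * (of_real (twist_angle' w v) * (\<i> * cis (twist_angle w))) +
        of_real (- (6 * (v \<bullet> sgn w)) / (5 + ?r)\<^sup>2) * cis (twist_angle w)) * w
      = disc_map w * log_derivative w (v * inverse w)" for v
  proof -
    define s where "s = v * inverse w"
    have v: "v = w * s" using assms(1) by (simp add: s_def)
    have c: "of_real (- (6 * (v \<bullet> sgn w)) / (5 + ?r)\<^sup>2)
        = - (of_real (6 / (5 + ?r)) * complex_of_real (?r * Re s / (5 + ?r)))"
      unfolding v inner_mult_sgn using r by (simp add: power2_eq_square)
    have "A * c * (w * s) + (A * (t * (\<i> * c)) + - (A * q) * c) * w = A * c * w * (s - q + \<i> * t)"
      for A c q t by (simp add: algebra_simps)
    then show ?thesis
      unfolding log_derivative_def s_def[symmetric] c unfolding v disc_map_def by blast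
  qed
  ultimately show ?thesis by (simp add: disc_map_def[abs_def])
qed

text \<open>The sum of the bounds on the terms of \<open>log_derivative\<close>: 1 for
  \<open>s\<close>, 1 for the radial term, 1 for the gradient of \<open>cmod (1 - w)\<close>, and
  \<open>1 + pi / ln (6/5)\<close> for the damped phase.\<close>

definition log_bound :: real where "log_bound = 4 + pi / ln (6/5)"

lemma twist_angle'_linear: "linear (twist_angle' w)"
  by (intro linearI) (simp_all add: twist_angle'_def inner_add_left algebra_simps add_divide_distrib diff_divide_distrib)

lemma log_derivative_linear: "linear (log_derivative w)"
  by (intro linearI)
    (simp_all add: log_derivative_def distrib_left linear_add[OF twist_angle'_linear]
      linear_cmul[OF twist_angle'_linear] complex_eq_iff right_diff_distrib add_divide_distrib)

lemma log_derivative_bound: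
  assumes "w \<noteq> 0" "cmod w < 1"
  shows "cmod (log_derivative w s) \<le> log_bound * cmod s"
proof -
  let ?r = "cmod w"
  have r: "0 < ?r" using assms by simp
  have "cmod (of_real (?r * Re s / (5 + ?r))) = ?r / (5 + ?r) * \<bar>Re s\<bar>"
    using r by (simp add: abs_mult norm_divide del: of_real_add of_real_divide)
  also have "\<dots> \<le> 1 * cmod s"
    using r by (intro mult_mono abs_Re_le_cmod) (auto simp: divide_le_eq_1 add_pos_pos)
  finally have 1: "cmod (of_real (?r * Re s / (5 + ?r))) \<le> cmod s" by simp
  have "\<bar>(w * s) \<bullet> sgn (1 - w)\<bar> \<le> cmod (w * s) * cmod (sgn (1 - w))"
    by (rule Cauchy_Schwarz_ineq2)
  also have "\<dots> \<le> (1 * cmod s) * 1"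
    unfolding norm_mult using assms by (intro mult_mono) (auto simp: norm_sgn)
  finally have 2: "\<bar>(w * s) \<bullet> sgn (1 - w)\<bar> \<le> cmod s" by simp
  have "\<bar>damp' ?r * ((w * s) \<bullet> sgn w)\<bar> = \<bar>?r * damp' ?r\<bar> * \<bar>Re s\<bar>"
    by (simp add: inner_mult_sgn abs_mult)
  also have "\<dots> \<le> (1 + pi / ln (6/5)) * cmod s"
    using r assms by (intro mult_mono damp'_bound abs_Re_le_cmod) auto
  finally have 3: "\<bar>damp' ?r * ((w * s) \<bullet> sgn w)\<bar> \<le> (1 + pi / ln (6/5)) * cmod s" .
  have "\<bar>(- x - y) / 2\<bar> \<le> a + b" if "\<bar>x\<bar> \<le> a" "\<bar>y\<bar> \<le> b" for x y a b :: real
    using that unfolding abs_le_iff by (elim conjE, intro conjI) (simp_all add: field_simps)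
  from this[OF 2 3] have "\<bar>twist_angle' w (w * s)\<bar> \<le> cmod s + (1 + pi / ln (6/5)) * cmod s"
    unfolding twist_angle'_def .
  then have 4: "cmod (\<i> * of_real (twist_angle' w (w * s))) \<le> cmod s + (1 + pi / ln (6/5)) * cmod s"
    by (simp add: norm_mult)
  have "cmod (log_derivative w s) \<le> cmod s + cmod s + (cmod s + (1 + pi / ln (6/5)) * cmod s)"
    unfolding log_derivative_def
    by (rule norm_triangle_le[OF add_mono[OF norm_triangle_le_diff 4]]) (use 1 in auto)
  then show ?thesis by (simp add: log_bound_def algebra_simps)
qed

text \<open>By triangularity only two diagonal entries matter. The radial one is
  \<open>5 / (5 + cmod w)\<close>, at least 5/6. In the angular one the phase term drops out, being
  constant on circles, and \<open>cmod (1 - w) / 2\<close> has slope at least -1/2, leaving at least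
  1/2. The oscillation of the phase thus never endangers orientation.\<close>

lemma log_derivative_jacobian:
  assumes "w \<noteq> 0" "cmod w < 1"
  shows "5/12 \<le> jac (log_derivative w)"
proof -
  let ?r = "cmod w"
  have r: "0 < ?r" "?r < 1" using assms by auto
  let ?a = "twist_angle' w (w * \<i>)"
  have "\<bar>(w * \<i>) \<bullet> sgn (1 - w)\<bar> \<le> cmod (w * \<i>) * cmod (sgn (1 - w))"
    by (rule Cauchy_Schwarz_ineq2)
  also have "\<dots> \<le> 1 * 1"
    unfolding norm_mult using assms by (intro mult_mono) (auto simp: norm_sgn)
  finally have "-1/2 \<le> ?a"
    unfolding twist_angle'_def inner_mult_sgn by simp
  then have "1/2 \<le> 1 + ?a" by simp
  moreover have "5/6 \<le> 5 / (5 + ?r)" using r by (intro divide_left_mono) (auto intro!: add_pos_nonneg)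
  ultimately have "5/6 * (1/2) \<le> 5 / (5 + ?r) * (1 + ?a)"
    using r by (intro mult_mono) auto
  moreover have "jac (log_derivative w) = (1 - ?r / (5 + ?r)) * (1 + ?a)"
    by (simp add: jac_def log_derivative_def)
  moreover have "1 - ?r / (5 + ?r) = 5 / (5 + ?r)"
  proof -
    have "5 + ?r \<noteq> 0" using r by linarith
    then show ?thesis by (simp add: divide_simps)
  qed
  ultimately show ?thesis by simp
qed

definition disc_distortion :: real where "disc_distortion = log_bound\<^sup>2 / (5/12)"

lemma disc_map_derivative_bounds:
  assumes "w \<noteq> 0" "cmod w < 1"
  shows "distortion_le disc_distortion (\<lambda>v. disc_map w * log_derivative w (v * inverse w))"
    and "cmod (disc_map w * log_derivative w (v * inverse w)) \<le> 6/5 * log_bound * cmod v"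
proof -
  have "distortion_le disc_distortion (log_derivative w)"
    unfolding disc_distortion_def
    by (rule distortion_leI[OF log_derivative_linear _ log_derivative_jacobian[OF assms]
          log_derivative_bound[OF assms]]) simp
  from distortion_le_compose[OF distortion_le_mult
      distortion_le_compose[OF this distortion_le_mult_right]]
  show "distortion_le disc_distortion (\<lambda>v. disc_map w * log_derivative w (v * inverse w))"
    by simp
  have "cmod (disc_map w * log_derivative w (v * inverse w))
      \<le> (6/5 * cmod w) * (log_bound * cmod (v * inverse w))"
    unfolding norm_mult[of "disc_map w"]
    by (intro mult_mono cmod_disc_map_le log_derivative_bound[OF assms]) auto
  also have "\<dots> = 6/5 * log_bound * cmod v"
    using assms(1) by (simp add: norm_mult norm_inverse norm_divide)
  finally show "cmod (disc_map w * log_derivative w (v * inverse w)) \<le> 6/5 * log_bound * cmod v" .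
qed

section \<open>Transfer to the plane\<close>

definition cayley :: "complex \<Rightarrow> complex" where
  "cayley w = (1 + w) / (1 - w)"

definition cayley_inv :: "complex \<Rightarrow> complex" where
  "cayley_inv z = (z - 1) / (z + 1)"

lemma Re_nonneg_imp_plus_1_neq_0: "0 \<le> Re z \<Longrightarrow> z + 1 \<noteq> 0"
  by (auto simp: complex_eq_iff)

lemma cayley_cayley_inv:
  assumes "z + 1 \<noteq> 0"
  shows "cayley (cayley_inv z) = z"
proof -
  have "1 + cayley_inv z = 2 * z / (z + 1)" "1 - cayley_inv z = 2 / (z + 1)"
    using assms by (simp_all add: cayley_inv_def divide_simps)
  then show ?thesis using assms by (simp add: cayley_def)
qed

lemma cayley_inv_cayley: "w \<noteq> 1 \<Longrightarrow> cayley_inv (cayley w) = w"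
  by (simp add: cayley_def cayley_inv_def field_simps)

lemma one_plus_cayley: "w \<noteq> 1 \<Longrightarrow> 1 + cayley w = 2 / (1 - w)"
  by (simp add: cayley_def field_simps)

lemma Re_cayley: "Re (cayley w) = (1 - (cmod w)\<^sup>2) / (cmod (1 - w))\<^sup>2"
  unfolding cmod_power2 cayley_def
  by (simp add: Re_divide power2_eq_square algebra_simps)

lemma cayley_inv_neq_1: "z + 1 \<noteq> 0 \<Longrightarrow> cayley_inv z \<noteq> 1"
  by (simp add: cayley_inv_def)

lemma cmod_minus_1_power2: "(cmod (z - 1))\<^sup>2 = (cmod (z + 1))\<^sup>2 - 4 * Re z"
  unfolding cmod_power2 by (simp add: power2_eq_square algebra_simps)

lemma cmod_cayley_inv_le_1: "0 \<le> Re z \<Longrightarrow> cmod (cayley_inv z) \<le> 1"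
  using cmod_minus_1_power2[of z] Re_nonneg_imp_plus_1_neq_0[of z]
    power2_le_imp_le[of "cmod (z - 1)" "cmod (z + 1)"]
  by (simp add: cayley_inv_def norm_divide)

lemma cmod_cayley_inv_less_1: "0 < Re z \<Longrightarrow> cmod (cayley_inv z) < 1"
  using cmod_minus_1_power2[of z] Re_nonneg_imp_plus_1_neq_0[of z]
    power2_less_imp_less[of "cmod (z - 1)" "cmod (z + 1)"]
  by (simp add: cayley_inv_def norm_divide)

lemma cmod_cayley_inv_eq_1: "Re z = 0 \<Longrightarrow> cmod (cayley_inv z) = 1"
  using cmod_minus_1_power2[of z] Re_nonneg_imp_plus_1_neq_0[of z]
  by (simp add: cayley_inv_def norm_divide)

lemma cayley_inv_eq_0_iff: "z + 1 \<noteq> 0 \<Longrightarrow> cayley_inv z = 0 \<longleftrightarrow> z = 1"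
  by (simp add: cayley_inv_def)

definition half_plane_map :: "complex \<Rightarrow> complex" where
  "half_plane_map z = cayley (disc_map (cayley_inv z))"

lemma disc_map_cayley_inv_neq_1: "0 \<le> Re z \<Longrightarrow> disc_map (cayley_inv z) \<noteq> 1"
  by (intro disc_map_neq_1 cmod_cayley_inv_le_1 cayley_inv_neq_1 Re_nonneg_imp_plus_1_neq_0)

lemma cayley_inv_half_plane_map:
  "0 \<le> Re z \<Longrightarrow> cayley_inv (half_plane_map z) = disc_map (cayley_inv z)"
  by (simp add: half_plane_map_def cayley_inv_cayley disc_map_cayley_inv_neq_1)

lemma Re_half_plane_map:
  shows "0 < Re z \<Longrightarrow> 0 < Re (half_plane_map z)"
    and "Re z = 0 \<Longrightarrow> Re (half_plane_map z) = 0"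
proof -
  assume z: "0 < Re z"
  have "cmod (disc_map (cayley_inv z)) < 1"
    using z by (intro cmod_disc_map_less_1 cmod_cayley_inv_less_1)
  then have "(cmod (disc_map (cayley_inv z)))\<^sup>2 < 1"
    by (simp add: abs_square_less_1)
  moreover have "0 < cmod (1 - disc_map (cayley_inv z))"
    using disc_map_cayley_inv_neq_1[of z] z by simp
  ultimately show "0 < Re (half_plane_map z)"
    unfolding half_plane_map_def Re_cayley by simp
next
  assume "Re z = 0"
  then have "cmod (disc_map (cayley_inv z)) = 1"
    using cmod_cayley_inv_eq_1 by (simp add: cmod_disc_map)
  then show "Re (half_plane_map z) = 0"
    unfolding half_plane_map_def Re_cayley by simp
qed

lemma half_plane_map_continuous: "continuous_on {z. 0 \<le> Re z} half_plane_map"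
proof -
  have 1: "continuous_on {z. 0 \<le> Re z} cayley_inv"
    unfolding cayley_inv_def
    by (intro continuous_intros) (use Re_nonneg_imp_plus_1_neq_0 in auto)
  have 2: "continuous_on {z. 0 \<le> Re z} (\<lambda>z. disc_map (cayley_inv z))"
    by (rule continuous_on_compose2[OF disc_map_continuous 1])
      (auto intro: cmod_cayley_inv_le_1)
  show ?thesis
    unfolding half_plane_map_def cayley_def
    by (intro continuous_intros 2) (use disc_map_cayley_inv_neq_1 in auto)
qed

definition half_plane_derivative :: "complex \<Rightarrow> complex \<Rightarrow> complex" where
  "half_plane_derivative z v = 2 / (1 - disc_map (cayley_inv z))\<^sup>2 *
     (disc_map (cayley_inv z) *
      log_derivative (cayley_inv z) (2 / (z + 1)\<^sup>2 * v * inverse (cayley_inv z)))"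

lemma half_plane_map_has_derivative:
  assumes "0 < Re z" "z \<noteq> 1"
  shows "(half_plane_map has_derivative half_plane_derivative z) (at z)"
proof -
  have z1: "z + 1 \<noteq> 0" using assms(1) Re_nonneg_imp_plus_1_neq_0 by auto
  let ?w = "cayley_inv z"
  have w: "?w \<noteq> 0" "cmod ?w < 1"
    using assms z1 by (auto simp: cayley_inv_eq_0_iff cmod_cayley_inv_less_1)
  have W: "1 - disc_map ?w \<noteq> 0"
    using disc_map_cayley_inv_neq_1[of z] assms(1) by simp
  have "(cayley_inv has_field_derivative 2 / (z + 1)\<^sup>2) (at z)"
    unfolding cayley_inv_def
    using z1 by (auto intro!: derivative_eq_intros simp: power2_eq_square field_simps)
  then have 1: "(cayley_inv has_derivative (\<lambda>v. 2 / (z + 1)\<^sup>2 * v)) (at z)"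
    by (rule has_field_derivative_imp_has_derivative)
  have "(cayley has_field_derivative 2 / (1 - disc_map ?w)\<^sup>2) (at (disc_map ?w))"
    unfolding cayley_def
    using W by (auto intro!: derivative_eq_intros simp: power2_eq_square field_simps)
  then have 3: "(cayley has_derivative (\<lambda>v. 2 / (1 - disc_map ?w)\<^sup>2 * v)) (at (disc_map ?w))"
    by (rule has_field_derivative_imp_has_derivative)
  have 2: "((\<lambda>z. disc_map (cayley_inv z)) has_derivative
      (\<lambda>v. disc_map ?w * log_derivative ?w (2 / (z + 1)\<^sup>2 * v * inverse ?w))) (at z)"
    by (rule has_derivative_compose[where f = cayley_inv and g = disc_map, OF 1 disc_map_has_derivative[OF w]])
  show ?thesis
    unfolding half_plane_map_def[abs_def] half_plane_derivative_def[abs_def]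
    by (rule has_derivative_compose[where f = "\<lambda>z. disc_map (cayley_inv z)" and g = cayley, OF 2 3])
qed

text \<open>Both Cayley factors are conformal, so the distortion is that of the disc map. The second
  bound is phrased through the value of the map because a continuous majorant of the derivative is
  wanted later.\<close>

lemma half_plane_derivative_bounds:
  assumes "0 < Re z" "z \<noteq> 1"
  shows "distortion_le disc_distortion (half_plane_derivative z)"
    and "cmod (half_plane_derivative z v)
      \<le> 6/5 * log_bound * (1 + cmod (half_plane_map z))\<^sup>2 * cmod v"
proof -
  have z1: "z + 1 \<noteq> 0" using assms(1) Re_nonneg_imp_plus_1_neq_0 by auto
  let ?w = "cayley_inv z"
  let ?W = "disc_map ?w"
  have w: "?w \<noteq> 0" "cmod ?w < 1"
    using assms z1 by (auto simp: cayley_inv_eq_0_iff cmod_cayley_inv_less_1)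
  have W: "?W \<noteq> 1"
    using disc_map_cayley_inv_neq_1[of z] assms(1) by simp
  show "distortion_le disc_distortion (half_plane_derivative z)"
    using distortion_le_compose[OF distortion_le_mult[of "2 / (1 - ?W)\<^sup>2"]
        distortion_le_compose[OF disc_map_derivative_bounds(1)[OF w]
          distortion_le_mult[of "2 / (z + 1)\<^sup>2"]]]
    unfolding half_plane_derivative_def[abs_def] by (simp only: mult_1_left mult_1_right)
  have lb: "0 \<le> log_bound" by (simp add: log_bound_def)
  \<comment> \<open>The derivative of \<open>cayley\<close> at \<open>?W\<close>, rewritten with
    \<open>1 + cayley W = 2 / (1 - W)\<close>.\<close>
  have "2 / (1 - ?W)\<^sup>2 = (1 + half_plane_map z)\<^sup>2 / 2"
    unfolding half_plane_map_def one_plus_cayley[OF W] by (simp add: power2_eq_square)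
  then have "cmod (2 / (1 - ?W)\<^sup>2) = (cmod (1 + half_plane_map z))\<^sup>2 / 2"
    by (simp only:) (simp add: norm_divide norm_power)
  also have "\<dots> \<le> (1 + cmod (half_plane_map z))\<^sup>2 / 2"
    using norm_triangle_ineq[of 1 "half_plane_map z"] by (intro divide_right_mono power_mono) auto
  finally have 1: "cmod (2 / (1 - ?W)\<^sup>2) \<le> (1 + cmod (half_plane_map z))\<^sup>2 / 2" .
  have "1 \<le> cmod (z + 1)"
    using complex_Re_le_cmod[of "z + 1"] assms(1) by simp
  then have "1 \<le> (cmod (z + 1))\<^sup>2" by simp
  then have "cmod (2 / (z + 1)\<^sup>2) \<le> 2"
    by (simp add: norm_divide norm_power divide_le_eq)
  then have 2: "cmod (2 / (z + 1)\<^sup>2 * v) \<le> 2 * cmod v"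
    unfolding norm_mult by (intro mult_right_mono) auto
  have "cmod (half_plane_derivative z v)
     \<le> (1 + cmod (half_plane_map z))\<^sup>2 / 2 * (6/5 * log_bound * cmod (2 / (z + 1)\<^sup>2 * v))"
    unfolding half_plane_derivative_def norm_mult[of "2 / (1 - ?W)\<^sup>2"]
    by (intro mult_mono 1 disc_map_derivative_bounds(2)[OF w]) auto
  also have "\<dots> \<le> (1 + cmod (half_plane_map z))\<^sup>2 / 2 * (6/5 * log_bound * (2 * cmod v))"
    using lb by (intro mult_left_mono 2) auto
  finally show "cmod (half_plane_derivative z v)
      \<le> 6/5 * log_bound * (1 + cmod (half_plane_map z))\<^sup>2 * cmod v" by (simp add: mult_ac)
qed

section \<open>Reflection across the imaginary axis\<close>

definition mirror_map :: "complex \<Rightarrow> complex" where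
  "mirror_map z = (if 0 \<le> Re z then half_plane_map z else - cnj (half_plane_map (- cnj z)))"

lemma mirror_map_continuous: "continuous_on UNIV mirror_map"
proof -
  have 1: "continuous_on {z. Re z \<le> 0} (\<lambda>z. - cnj (half_plane_map (- cnj z)))"
    by (intro continuous_intros continuous_on_compose2[OF half_plane_map_continuous]) auto
  have "continuous_on UNIV (\<lambda>z. if - Re z \<le> 0 then half_plane_map z else - cnj (half_plane_map (- cnj z)))"
  proof (rule continuous_on_cases_le)
    fix z assume "- Re z = 0"
    then have z: "- cnj z = z" and "Re z = 0" by (simp_all add: complex_eq_iff)
    then have "Re (half_plane_map z) = 0" using Re_half_plane_map(2) by blast
    then show "half_plane_map z = - cnj (half_plane_map (- cnj z))"
      unfolding z by (simp add: complex_eq_iff)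
  qed (use half_plane_map_continuous 1 in \<open>auto intro!: continuous_intros\<close>)
  then show ?thesis by (simp add: mirror_map_def[abs_def])
qed

definition mirror_derivative :: "complex \<Rightarrow> complex \<Rightarrow> complex" where
  "mirror_derivative z = (if 0 \<le> Re z then half_plane_derivative z
     else (\<lambda>v. - cnj (half_plane_derivative (- cnj z) (- cnj v))))"

lemma mirror_map_has_derivative:
  assumes "Re z \<noteq> 0" "z \<notin> {1, -1}"
  shows "(mirror_map has_derivative mirror_derivative z) (at z)"
proof (cases "0 < Re z")
  case True
  have "(half_plane_map has_derivative half_plane_derivative z) (at z)"
    using True assms by (intro half_plane_map_has_derivative) auto
  then have "(mirror_map has_derivative half_plane_derivative z) (at z)"
    by (rule has_derivative_transform_within_open[where s = "{z. 0 < Re z}"])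
      (use True in \<open>auto simp: mirror_map_def open_halfspace_Re_gt\<close>)
  then show ?thesis using True by (simp add: mirror_derivative_def)
next
  case False
  then have z: "Re z < 0" using assms by auto
  have "- cnj z \<noteq> 1" using assms by (auto simp: complex_eq_iff)
  then have d: "(half_plane_map has_derivative half_plane_derivative (- cnj z)) (at (- cnj z))"
    using z by (intro half_plane_map_has_derivative) auto
  have c: "((\<lambda>z. - cnj z) has_derivative (\<lambda>v. - cnj v)) (at z)"
    by (intro derivative_intros)
  have "((\<lambda>z. - cnj (half_plane_map (- cnj z))) has_derivative
      (\<lambda>v. - cnj (half_plane_derivative (- cnj z) (- cnj v)))) (at z)"
    by (intro has_derivative_minus has_derivative_cnj)
      (rule has_derivative_compose[where f = "\<lambda>z. - cnj z" and g = half_plane_map, OF c d])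
  then have "(mirror_map has_derivative
      (\<lambda>v. - cnj (half_plane_derivative (- cnj z) (- cnj v)))) (at z)"
    by (rule has_derivative_transform_within_open[where s = "{z. Re z < 0}"])
      (use z in \<open>auto simp: mirror_map_def open_halfspace_Re_lt\<close>)
  then show ?thesis using z by (simp add: mirror_derivative_def)
qed

lemma mirror_derivative_bounds:
  assumes "Re z \<noteq> 0" "z \<notin> {1, -1}"
  shows "distortion_le disc_distortion (mirror_derivative z)"
    and "cmod (mirror_derivative z v)
      \<le> 6/5 * log_bound * (1 + cmod (mirror_map z))\<^sup>2 * cmod v"
proof -
  consider "0 < Re z" "z \<noteq> 1" | "Re z < 0" "0 < Re (- cnj z)" "- cnj z \<noteq> 1"
    using assms by (cases "Re z < 0") (auto simp: complex_eq_iff)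
  then have "distortion_le disc_distortion (mirror_derivative z) \<and>
    cmod (mirror_derivative z v) \<le> 6/5 * log_bound * (1 + cmod (mirror_map z))\<^sup>2 * cmod v"
  proof cases
    case 1
    then show ?thesis
      using half_plane_derivative_bounds[OF 1] by (simp add: mirror_derivative_def mirror_map_def)
  next
    case 2
    have "cmod (- cnj (half_plane_derivative (- cnj z) (- cnj v)))
        \<le> 6/5 * log_bound * (1 + cmod (half_plane_map (- cnj z)))\<^sup>2 * cmod v"
      using half_plane_derivative_bounds(2)[OF 2(2,3), of "- cnj v"] by simp
    then show ?thesis
      using distortion_le_reflect[OF half_plane_derivative_bounds(1)[OF 2(2,3)]] 2(1)
      by (simp add: mirror_derivative_def mirror_map_def)
  qed
  then show "distortion_le disc_distortion (mirror_derivative z)"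
    and "cmod (mirror_derivative z v) \<le> 6/5 * log_bound * (1 + cmod (mirror_map z))\<^sup>2 * cmod v"
    by auto
qed

section \<open>The transcendental factor\<close>

text \<open>A continuously differentiable ramp; nesting two of them gives a smooth enough step with
  an explicit derivative.\<close>

definition pos_sq :: "real \<Rightarrow> real" where "pos_sq y = (max 0 y)\<^sup>2"

lemma pos_sq_has_derivative: "(pos_sq has_field_derivative 2 * max 0 y) (at y)"
proof -
  consider "y < 0" | "y = 0" | "0 < y" by linarith
  then show ?thesis
  proof cases
    case 1
    have "((\<lambda>_. 0) has_field_derivative 0) (at y)" by simp
    then have "(pos_sq has_field_derivative 0) (at y)"
      by (rule has_field_derivative_transform_within_open[where S = "{..<0}"])
        (use 1 in \<open>auto simp: pos_sq_def\<close>)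
    then show ?thesis using 1 by simp
  next
    case 2
    have "((\<lambda>h. (pos_sq (0 + h) - pos_sq 0) / h) \<longlongrightarrow> 0) (at 0)"
    proof (rule Lim_null_comparison)
      show "\<forall>\<^sub>F h in at 0. norm ((pos_sq (0 + h) - pos_sq 0) / h) \<le> \<bar>h\<bar>"
        by (intro always_eventually allI) (auto simp: pos_sq_def power2_eq_square max_def)
      show "((\<lambda>h. \<bar>h\<bar>) \<longlongrightarrow> (0::real)) (at 0)" by (auto intro!: tendsto_eq_intros)
    qed
    then show ?thesis using 2 by (simp add: DERIV_def)
  next
    case 3
    have "((\<lambda>y. y\<^sup>2) has_field_derivative 2 * y) (at y)" by (auto intro!: derivative_eq_intros)
    then have "(pos_sq has_field_derivative 2 * y) (at y)"
      by (rule has_field_derivative_transform_within_open[where S = "{0<..}"])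
        (use 3 in \<open>auto simp: pos_sq_def\<close>)
    then show ?thesis using 3 by simp
  qed
qed

text \<open>A step from 1/60 on \<open>x \<le> -1\<close> to 0 on \<open>x \<ge> 0\<close>. In the
  strip between, \<open>exp (- x) \<le> 3\<close>, and the value and slope bounds 1/60 and 1/15 add
  up to 1/12, so the derivative of the shear deviates from the identity by at most 3/12 =
  1/4.\<close>

definition cutoff :: "real \<Rightarrow> real" where
  "cutoff x = (1 - pos_sq (1 - pos_sq (- x))) / 60"

definition cutoff' :: "real \<Rightarrow> real" where
  "cutoff' x = - (max 0 (1 - pos_sq (- x)) * max 0 (- x)) / 15"

lemma cutoff_has_derivative: "(cutoff has_field_derivative cutoff' x) (at x)"
proof -
  have "((\<lambda>x. pos_sq (- x)) has_field_derivative 2 * max 0 (- x) * (- 1)) (at x)"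
    by (rule DERIV_chain2[OF pos_sq_has_derivative]) (auto intro!: derivative_eq_intros)
  then have "((\<lambda>x. 1 - pos_sq (- x)) has_field_derivative 2 * max 0 (- x)) (at x)"
    by (auto intro!: derivative_eq_intros)
  from DERIV_chain2[OF pos_sq_has_derivative this]
  have "((\<lambda>x. (1 - pos_sq (1 - pos_sq (- x))) / 60) has_field_derivative
      (0 - 2 * max 0 (1 - pos_sq (- x)) * (2 * max 0 (- x))) / 60) (at x)"
    by (intro DERIV_cdivide DERIV_diff DERIV_const)
  then show ?thesis
    by (simp add: cutoff_def[abs_def] cutoff'_def mult_ac)
qed

lemma pos_sq_ge_1: "1 \<le> y \<Longrightarrow> 1 \<le> pos_sq y"
  by (simp add: pos_sq_def)

lemma pos_sq_le_1: "y \<le> 1 \<Longrightarrow> pos_sq y \<le> 1"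
  by (auto simp: pos_sq_def max_def abs_square_le_1)

lemma cutoff_values:
  "0 \<le> x \<Longrightarrow> cutoff x = 0" "0 \<le> x \<Longrightarrow> cutoff' x = 0"
  "x \<le> -1 \<Longrightarrow> cutoff x = 1/60" "x \<le> -1 \<Longrightarrow> cutoff' x = 0"
  using pos_sq_ge_1[of "- x"] by (auto simp: cutoff_def cutoff'_def pos_sq_def max_def)

lemma cutoff_bounds: "0 \<le> cutoff x" "cutoff x \<le> 1/60" "\<bar>cutoff' x\<bar> \<le> 1/15"
proof -
  have nn: "0 \<le> pos_sq y" for y by (simp add: pos_sq_def)
  show "0 \<le> cutoff x" using pos_sq_le_1[of "1 - pos_sq (- x)"] nn[of "- x"] by (simp add: cutoff_def)
  show "cutoff x \<le> 1/60" using nn by (simp add: cutoff_def)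
  show "\<bar>cutoff' x\<bar> \<le> 1/15"
  proof (cases "x \<le> -1")
    case True
    then show ?thesis by (simp add: cutoff_values)
  next
    case False
    have "max 0 (1 - pos_sq (- x)) * max 0 (- x) \<le> 1 * 1"
      using False nn[of "- x"] by (intro mult_mono) auto
    then show ?thesis by (simp add: cutoff'_def abs_mult)
  qed
qed

text \<open>The identity for \<open>Re u \<ge> 0\<close> and a transcendental entire function for \<open>Re u \<le> -1\<close>.\<close>

definition exp_shear :: "complex \<Rightarrow> complex" where
  "exp_shear u = u + of_real (cutoff (Re u)) * exp (- u)"

definition exp_shear' :: "complex \<Rightarrow> complex \<Rightarrow> complex" where
  "exp_shear' u v = v + of_real (cutoff' (Re u) * Re v) * exp (- u) - of_real (cutoff (Re u)) * exp (- u) * v"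

lemma exp_shear_has_derivative: "(exp_shear has_derivative exp_shear' u) (at u)"
proof -
  have 1: "((\<lambda>u. cutoff (Re u)) has_derivative (\<lambda>v. cutoff' (Re u) * Re v)) (at u)"
    by (rule has_derivative_compose[where f = Re and g = cutoff, OF _
          has_field_derivative_imp_has_derivative[OF cutoff_has_derivative]])
      (intro derivative_intros)
  have "((\<lambda>u. exp (- u)) has_field_derivative - exp (- u)) (at u)"
    by (auto intro!: derivative_eq_intros)
  then have 2: "((\<lambda>u. exp (- u)) has_derivative (\<lambda>v. - exp (- u) * v)) (at u)"
    by (rule has_field_derivative_imp_has_derivative)
  have "((\<lambda>u. u + of_real (cutoff (Re u)) * exp (- u)) has_derivative
     (\<lambda>v. v + (of_real (cutoff (Re u)) * (- exp (- u) * v) +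
          of_real (cutoff' (Re u) * Re v) * exp (- u)))) (at u)"
    by (intro has_derivative_add has_derivative_mult has_derivative_of_real 1 2 has_derivative_ident)
  then show ?thesis
    by (simp add: exp_shear_def[abs_def] exp_shear'_def[abs_def] algebra_simps)
qed

lemma exp_shear'_near_id:
  "cmod (exp_shear' u v - v) \<le> exp (- Re u) / 12 * cmod v"
proof -
  have "\<bar>cutoff' (Re u)\<bar> * \<bar>Re v\<bar> \<le> 1/15 * cmod v"
    by (intro mult_mono cutoff_bounds abs_Re_le_cmod) auto
  then have 1: "cmod (of_real (cutoff' (Re u) * Re v) * exp (- u)) \<le> 1/15 * cmod v * exp (- Re u)"
    unfolding norm_mult[of _ "exp (- u)"] norm_of_real abs_mult norm_exp_eq_Re
    by (simp only: uminus_complex.sel) (rule mult_right_mono, simp_all)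
  have "cmod (of_real (cutoff (Re u)) * exp (- u) * v) = cutoff (Re u) * (exp (- Re u) * cmod v)"
    using cutoff_bounds(1)[of "Re u"] by (simp add: norm_mult)
  also have "\<dots> \<le> 1/60 * (exp (- Re u) * cmod v)"
    by (intro mult_right_mono cutoff_bounds) auto
  finally have 2: "cmod (of_real (cutoff (Re u)) * exp (- u) * v) \<le> 1/60 * (exp (- Re u) * cmod v)" .
  have "exp_shear' u v - v = of_real (cutoff' (Re u) * Re v) * exp (- u) - of_real (cutoff (Re u)) * exp (- u) * v"
    by (simp add: exp_shear'_def)
  then have "cmod (exp_shear' u v - v) \<le> 1/15 * cmod v * exp (- Re u) + 1/60 * (exp (- Re u) * cmod v)"
    by (simp only:) (rule order_trans[OF norm_triangle_ineq4 add_mono[OF 1 2]])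
  then show ?thesis by (simp add: algebra_simps)
qed

text \<open>All matrix entries are within 1/4 of those of the identity, so the Jacobian is at least
  9/16 - 1/16 = 1/2, and (5/4)^2 / (1/2) = 25/8 is below 4.\<close>

lemma distortion_le_near_id:
  assumes lin: "linear L" and near: "\<And>v. cmod (L v - v) \<le> cmod v / 4"
  shows "distortion_le 4 L"
proof -
  have b: "cmod (L v) \<le> 5/4 * cmod v" for v
    using norm_triangle_ineq[of "L v - v" v] near[of v] by simp
  have "\<bar>Re (L 1 - 1)\<bar> \<le> 1/4" "\<bar>Im (L 1 - 1)\<bar> \<le> 1/4" "\<bar>Re (L \<i> - \<i>)\<bar> \<le> 1/4" "\<bar>Im (L \<i> - \<i>)\<bar> \<le> 1/4"
    using order_trans[OF abs_Re_le_cmod near[of 1]] order_trans[OF abs_Im_le_cmod near[of 1]]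
      order_trans[OF abs_Re_le_cmod near[of \<i>]] order_trans[OF abs_Im_le_cmod near[of \<i>]]
    by (simp_all only: norm_one norm_ii)
  then have e: "3/4 \<le> Re (L 1)" "\<bar>Im (L 1)\<bar> \<le> 1/4" "\<bar>Re (L \<i>)\<bar> \<le> 1/4" "3/4 \<le> Im (L \<i>)"
    unfolding minus_complex.sel one_complex.sel imaginary_unit.sel by linarith+
  have "3/4 * (3/4) \<le> Re (L 1) * Im (L \<i>)" using e by (intro mult_mono) auto
  moreover have "\<bar>Im (L 1)\<bar> * \<bar>Re (L \<i>)\<bar> \<le> 1/4 * (1/4)" using e by (intro mult_mono) auto
  then have "\<bar>Im (L 1) * Re (L \<i>)\<bar> \<le> 1/16" by (simp add: abs_mult)
  ultimately have "1/2 \<le> jac L" unfolding jac_def by linarith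
  from distortion_leI[OF lin _ this b] have "distortion_le ((5/4)\<^sup>2 / (1/2)) L" by simp
  then show ?thesis by (rule distortion_le_mono) (simp_all add: power2_eq_square)
qed

text \<open>Outside the strip the cutoff is locally constant or has slope 0, so the derivative is
  multiplication by a complex number and thus conformal, however large \<open>exp (- u)\<close> is.
  Only the strip needs an estimate.\<close>

lemma exp_shear'_distortion: "distortion_le 4 (exp_shear' u)"
proof (cases "-1 < Re u \<and> Re u < 0")
  case True
  have "linear (exp_shear' u)"
    using exp_shear_has_derivative by (rule has_derivative_linear)
  moreover have "cmod (exp_shear' u v - v) \<le> cmod v / 4" for v
  proof -
    have "exp (- Re u) \<le> exp 1" using True by simp
    also have "\<dots> \<le> 3" by (rule exp_le)
    finally have "exp (- Re u) / 12 * cmod v \<le> 1/4 * cmod v" by (intro mult_right_mono) auto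
    then show ?thesis using exp_shear'_near_id[of u v] by linarith
  qed
  ultimately show ?thesis by (rule distortion_le_near_id)
next
  case False
  then have "cutoff' (Re u) = 0" by (cases "Re u \<le> -1") (auto simp: cutoff_values)
  then have "exp_shear' u = (*) (1 - of_real (cutoff (Re u)) * exp (- u))"
    by (auto simp: exp_shear'_def fun_eq_iff algebra_simps)
  then have "distortion_le 1 (exp_shear' u)" by (simp add: distortion_le_mult)
  then show ?thesis by (rule distortion_le_mono) auto
qed

lemma exp_shear'_bound: "cmod (exp_shear' u v) \<le> (1 + exp (- Re u)) * cmod v"
proof -
  have "cmod (exp_shear' u v) \<le> cmod (exp_shear' u v - v) + cmod v"
    using norm_triangle_ineq[of "exp_shear' u v - v" v] by simp
  also have "\<dots> \<le> exp (- Re u) / 12 * cmod v + cmod v"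
    using exp_shear'_near_id by simp
  also have "\<dots> \<le> exp (- Re u) * cmod v + cmod v"
    by (intro add_right_mono mult_right_mono) auto
  finally show ?thesis by (simp add: algebra_simps)
qed

section \<open>The composed map and its quasiregularity\<close>

definition qr_map :: "complex \<Rightarrow> complex" where
  "qr_map z = exp_shear (mirror_map z)"

definition plane_map :: "real^2 \<Rightarrow> real^2" where
  "plane_map x = vec2_of_complex (qr_map (complex_of_vec2 x))"

lemma qr_map_continuous: "continuous_on UNIV qr_map"
proof -
  have "continuous_on UNIV exp_shear"
    by (rule has_derivative_continuous_on)
      (rule has_derivative_at_withinI[OF exp_shear_has_derivative])
  then show ?thesis
    unfolding qr_map_def by (rule continuous_on_compose2[OF _ mirror_map_continuous]) auto
qed

lemma disc_distortion_ge_1: "1 \<le> disc_distortion"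
proof -
  have "1 \<le> log_bound" by (simp add: log_bound_def)
  then have "1 \<le> log_bound\<^sup>2" by simp
  then show ?thesis by (simp add: disc_distortion_def)
qed

lemma quasiregular_plane_map: "quasiregular plane_map"
  unfolding plane_map_def[abs_def]
proof (rule quasiregular_of_complex)
  let ?L = "\<lambda>z v. exp_shear' (mirror_map z) (mirror_derivative z v)"
  let ?M = "\<lambda>z. (1 + exp (- Re (mirror_map z))) * (6/5 * log_bound * (1 + cmod (mirror_map z))\<^sup>2)"
  show "continuous_on UNIV qr_map" by (rule qr_map_continuous)
  \<comment> \<open>The point \<open>1\<close> corresponds to the centre of the disc, where the
    phase oscillates, and \<open>-1\<close> is its mirror image.\<close>
  show "finite {1, -1 :: complex}" by simp
  show "1 \<le> 4 * disc_distortion" using disc_distortion_ge_1 by simp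
  show "continuous_on UNIV ?M"
    by (intro continuous_intros mirror_map_continuous)
  fix z :: complex assume z: "Re z \<noteq> 0" "z \<notin> {1, -1}"
  show "(qr_map has_derivative ?L z) (at z)"
    unfolding qr_map_def[abs_def]
    by (rule has_derivative_compose[where f = mirror_map and g = exp_shear,
          OF mirror_map_has_derivative[OF z] exp_shear_has_derivative])
  show "distortion_le (4 * disc_distortion) (?L z)"
    by (rule distortion_le_compose[OF exp_shear'_distortion mirror_derivative_bounds(1)[OF z]])
  fix v
  have "cmod (?L z v) \<le> (1 + exp (- Re (mirror_map z))) * cmod (mirror_derivative z v)"
    by (rule exp_shear'_bound)
  also have "\<dots> \<le> (1 + exp (- Re (mirror_map z))) *
      (6/5 * log_bound * (1 + cmod (mirror_map z))\<^sup>2 * cmod v)"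
    by (intro mult_left_mono mirror_derivative_bounds(2)[OF z]) (auto intro: add_nonneg_nonneg)
  finally show "cmod (?L z v) \<le> ?M z * cmod v" by (simp only: mult.assoc)
qed

section \<open>Dynamics\<close>

lemma qr_map_right: "0 \<le> Re z \<Longrightarrow> qr_map z = half_plane_map z"
proof -
  assume z: "0 \<le> Re z"
  then have "0 \<le> Re (half_plane_map z)"
    using Re_half_plane_map[of z] by (cases "Re z = 0") auto
  then show ?thesis using z by (simp add: qr_map_def mirror_map_def exp_shear_def cutoff_values)
qed

lemma qr_map_funpow:
  assumes "0 < Re z"
  shows "0 < Re ((qr_map ^^ n) z)"
    and "cayley_inv ((qr_map ^^ n) z) = (disc_map ^^ n) (cayley_inv z)"
proof -
  have "0 < Re ((qr_map ^^ n) z) \<and> cayley_inv ((qr_map ^^ n) z) = (disc_map ^^ n) (cayley_inv z)"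
  proof (induction n)
    case (Suc n)
    then show ?case
      by (simp add: qr_map_right Re_half_plane_map cayley_inv_half_plane_map)
  qed (use assms in simp)
  then show "0 < Re ((qr_map ^^ n) z)"
    "cayley_inv ((qr_map ^^ n) z) = (disc_map ^^ n) (cayley_inv z)" by auto
qed

text \<open>The point \<open>1 + 2 * a\<close> corresponds to the radius \<open>r\<close> with
  \<open>r / (1 - r) = a\<close>. When \<open>a\<close> is a power of 6/5 the phase is 1, there is
  no rotation on the positive axis, and the radial step simply multiplies \<open>a\<close> by
  6/5.\<close>

lemma qr_map_escaping_orbit:
  "qr_map (of_real (1 + 2 * (6/5) ^ n)) = of_real (1 + 2 * (6/5) ^ Suc n)"
proof -
  define a :: real where "a = (6/5) ^ n"
  have a: "0 < a" by (simp add: a_def)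
  define r where "r = a / (a + 1)"
  have r: "0 < r" "r < 1" "r / (1 - r) = a" using a by (simp_all add: r_def field_simps)
  have "cayley_inv (of_real (1 + 2 * a)) = of_real ((1 + 2 * a - 1) / (1 + 2 * a + 1))"
    unfolding cayley_inv_def by (simp only: of_real_diff of_real_add of_real_divide of_real_1)
  also have "(1 + 2 * a - 1) / (1 + 2 * a + 1) = r" using a by (simp add: r_def field_simps)
  finally have w: "cayley_inv (of_real (1 + 2 * a)) = of_real r" .
  have "pi * ln (r / (1 - r)) / ln (6/5) = pi * real n"
    unfolding r(3) a_def by (simp add: ln_realpow)
  then have "phase r = 1"
    unfolding phase_def cos_squared_eq by simp
  moreover have "cmod (1 - of_real r) = 1 - r"
    using norm_of_real[of "1 - r", where 'a = complex] r by simp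
  ultimately have "twist_angle (of_real r) = 0"
    using r by (simp add: twist_angle_def)
  then have "disc_map (of_real r) = of_real (6 / (5 + r) * r)"
    using r by (simp add: disc_map_def)
  also have "6 / (5 + r) * r = 6 * a / (6 * a + 5)"
  proof -
    have eq: "5 + r = (6 * a + 5) / (a + 1)" using a by (simp add: r_def field_simps)
    have "6 / (b / c) * (x / c) = 6 * x / b" if "c \<noteq> 0" for b c x :: real
      using that by simp
    from this[of "a + 1" "6 * a + 5" a] show ?thesis
      unfolding eq unfolding r_def using a by simp
  qed
  finally have F: "disc_map (of_real r) = of_real (6 * a / (6 * a + 5))" .
  have "qr_map (of_real (1 + 2 * a)) = cayley (of_real (6 * a / (6 * a + 5)))"
    using a by (simp add: qr_map_right half_plane_map_def w F del: of_real_add of_real_divide of_real_mult)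
  also have "\<dots> = of_real ((1 + 6 * a / (6 * a + 5)) / (1 - 6 * a / (6 * a + 5)))"
    unfolding cayley_def by (simp only: of_real_diff of_real_add of_real_divide of_real_1)
  also have "(1 + 6 * a / (6 * a + 5)) / (1 - 6 * a / (6 * a + 5)) = 1 + 2 * (6/5 * a)"
  proof -
    have "6 * a + 5 \<noteq> 0" using a by linarith
    then have "1 + 6 * a / (6 * a + 5) = (12 * a + 5) / (6 * a + 5)"
      "1 - 6 * a / (6 * a + 5) = 5 / (6 * a + 5)" by (simp_all add: divide_simps)
    then show ?thesis using \<open>6 * a + 5 \<noteq> 0\<close> by simp
  qed
  finally show ?thesis by (simp add: a_def)
qed

lemma qr_map_funpow_3: "(qr_map ^^ n) 3 = of_real (1 + 2 * (6/5) ^ n)"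
  by (induction n) (simp_all only: funpow.simps o_apply id_apply qr_map_escaping_orbit, simp)

text \<open>With \<open>m n\<close> the negated argument and \<open>t n\<close> the rotation,
  \<open>m (Suc n) = m n - t n\<close> eventually. Convergence to 1 forces \<open>m\<close> to be
  nonnegative and to decay like (4/5)^n, yet it is at least \<open>t n\<close>, which decays no
  faster than (5/6)^n.\<close>

lemma disc_map_orbit_not_tendsto_1:
  assumes w: "w \<noteq> 0" "cmod w < 1" "phase (cmod w) \<le> 1/2"
  shows "\<not> (\<lambda>n. (disc_map ^^ n) w) \<longlonglongrightarrow> 1"
proof
  define u where "u n = (disc_map ^^ n) w" for n
  assume "(\<lambda>n. (disc_map ^^ n) w) \<longlonglongrightarrow> 1"
  then have lim: "u \<longlonglongrightarrow> 1" unfolding u_def[abs_def] .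
  have u_Suc: "u (Suc n) = disc_map (u n)" for n by (simp add: u_def)
  have u: "u n \<noteq> 0 \<and> cmod (u n) < 1 \<and> phase (cmod (u n)) \<le> 1/2" for n
  proof (induction n)
    case (Suc n)
    then have "phase (cmod (disc_map (u n))) = phase (cmod (u n))"
      using phase_step[of "cmod (u n)"] by (simp add: cmod_disc_map)
    then show ?case using Suc by (simp add: u_Suc cmod_disc_map_less_1)
  qed (use w in \<open>simp add: u_def\<close>)
  define t where "t n = twist_angle (u n)" for n
  have t: "0 \<le> t n" "cmod (1 - u n) / 4 \<le> t n" "t n \<le> cmod (1 - u n) / 2" for n
    using twist_angle_bounds[of "u n"] u[of n] by (auto simp: t_def)
  \<comment> \<open>The distance to the circle is multiplied by \<open>5 / (5 + cmod (u n))\<close>,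
    which exceeds 5/6 inside the disc.\<close>
  have gap: "(5/6) ^ n * (1 - cmod w) \<le> 1 - cmod (u n)" for n
  proof (induction n)
    case (Suc n)
    have "5/6 * (1 - cmod (u n)) \<le> 5 / (5 + cmod (u n)) * (1 - cmod (u n))"
    proof (rule mult_right_mono)
      have "5 / 6 \<le> 5 / (5 + cmod (u n))"
        using u[of n] by (intro divide_left_mono) (auto intro!: add_pos_nonneg)
      then show "5 / 6 \<le> 5 / (5 + cmod (u n))" .
    qed (use u[of n] in auto)
    also have "\<dots> = 1 - cmod (u (Suc n))"
      by (simp add: u_Suc one_minus_cmod_disc_map)
    finally show ?case using Suc by simp
  qed (simp add: u_def)
  define m where "m n = - Arg (u n)" for n
  have m_lim: "m \<longlonglongrightarrow> 0"
  proof -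
    have "isCont Arg 1" by (rule continuous_at_Arg) (simp add: complex_nonpos_Reals_iff)
    from isCont_tendsto_compose[OF this lim] show ?thesis
      unfolding m_def using tendsto_minus by fastforce
  qed
  have t_lim: "t \<longlonglongrightarrow> 0"
  proof (rule Lim_null_comparison)
    show "\<forall>\<^sub>F n in sequentially. norm (t n) \<le> cmod (1 - u n) / 2"
      using t by (intro always_eventually) auto
    have "(\<lambda>n. cmod (1 - u n) / 2) \<longlonglongrightarrow> cmod (1 - 1) / 2"
      by (intro tendsto_intros lim) auto
    then show "(\<lambda>n. cmod (1 - u n) / 2) \<longlonglongrightarrow> 0" by simp
  qed
  have small: "\<forall>\<^sub>F n in sequentially. \<bar>m n\<bar> < 1/2 \<and> \<bar>t n\<bar> < 1/2"
    using tendstoD[OF m_lim, of "1/2"] tendstoD[OF t_lim, of "1/2"]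
    by (auto simp: eventually_conj_iff)
  \<comment> \<open>Near 1 the quotient of \<open>Ln z\<close> by \<open>z - 1\<close> tends to 1,
    so any constant above 1 would bound it. The choice 5/4 combines with
    \<open>cmod (1 - u n) / 4 \<le> t n\<close> to give
    \<open>\<bar>m n\<bar> / 5 \<le> t n\<close>, hence the ratio 4/5.\<close>
  have "\<forall>\<^sub>F n in sequentially. \<bar>m n\<bar> \<le> 5/4 * cmod (1 - u n)"
  proof -
    have "(Ln has_field_derivative inverse 1) (at 1)"
      by (rule has_field_derivative_Ln) (simp add: complex_nonpos_Reals_iff)
    then have "((\<lambda>z. (Ln z - Ln 1) / (z - 1)) \<longlongrightarrow> 1) (at 1)"
      by (simp add: has_field_derivative_iff)
    moreover have "filterlim u (at 1) sequentially"
    proof -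
      have "u n \<noteq> 1" for n using u[of n] by auto
      then show ?thesis using lim by (simp add: filterlim_at)
    qed
    ultimately have "(\<lambda>n. (Ln (u n) - Ln 1) / (u n - 1)) \<longlonglongrightarrow> 1"
      by (rule filterlim_compose)
    then have "(\<lambda>n. cmod ((Ln (u n) - Ln 1) / (u n - 1))) \<longlonglongrightarrow> cmod 1"
      by (rule tendsto_norm)
    then have "\<forall>\<^sub>F n in sequentially. cmod ((Ln (u n) - Ln 1) / (u n - 1)) < 5/4"
      by (rule order_tendstoD) simp
    then show ?thesis
    proof eventually_elim
      case (elim n)
      have "u n \<noteq> 1" using u[of n] by auto
      then have "cmod (Ln (u n)) \<le> 5/4 * cmod (1 - u n)"
        using elim by (simp add: norm_divide divide_less_eq norm_minus_commute)
      moreover have "\<bar>m n\<bar> \<le> cmod (Ln (u n))"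
        using u[of n] abs_Im_le_cmod[of "Ln (u n)"] by (simp add: m_def Arg_eq_Im_Ln)
      ultimately show ?case by linarith
    qed
  qed
  with small obtain N where N: "\<And>n. N \<le> n \<Longrightarrow> \<bar>m n\<bar> < 1/2 \<and> \<bar>t n\<bar> < 1/2 \<and> \<bar>m n\<bar> \<le> 5/4 * cmod (1 - u n)"
    by (metis (mono_tags, lifting) eventually_conj eventually_sequentially)
  \<comment> \<open>Both the argument and the rotation are below 1/2 in absolute value, so their sum
    does not cross the branch cut of \<open>Arg\<close>.\<close>
  have m_Suc: "m (Suc n) = m n - t n" if "N \<le> n" for n
  proof -
    have "Arg (u (Suc n)) = Arg (u n) + t n"
    proof (rule Arg_unique)
      have "u n = of_real (cmod (u n)) * cis (Arg (u n))"
        using rcis_cmod_Arg[of "u n"] by (simp add: rcis_def)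
      then have "disc_map (u n) = of_real (6 / (5 + cmod (u n))) * cis (t n) * (of_real (cmod (u n)) * cis (Arg (u n)))"
        by (simp add: disc_map_def t_def)
      also have "\<dots> = of_real (6 / (5 + cmod (u n)) * cmod (u n)) * (cis (t n) * cis (Arg (u n)))"
        by (simp only: of_real_mult mult_ac)
      also have "\<dots> = of_real (cmod (u (Suc n))) * exp (\<i> * complex_of_real (Arg (u n) + t n))"
        by (simp add: cis_mult u_Suc cmod_disc_map add.commute del: of_real_divide of_real_mult of_real_add flip: cis_conv_exp)
      finally show "of_real (cmod (u (Suc n))) * exp (\<i> * complex_of_real (Arg (u n) + t n)) = u (Suc n)"
        by (simp add: u_Suc)
      show "0 < cmod (u (Suc n))" using u by simp
      show "- pi < Arg (u n) + t n" "Arg (u n) + t n \<le> pi"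
        using N[OF that] pi_gt3 by (auto simp: m_def abs_less_iff)
    qed
    then show ?thesis by (simp add: m_def)
  qed
  \<comment> \<open>From \<open>N\<close> on the sequence \<open>m\<close> is nonincreasing, so a
    negative value would keep it away from its limit 0: an orbit that has passed the positive axis
    can only turn further.\<close>
  have m_nonneg: "0 \<le> m n" if "N \<le> n" for n
  proof (rule ccontr)
    assume neg: "\<not> 0 \<le> m n"
    have "m (n + k) \<le> m n" for k
    proof (induction k)
      case (Suc k)
      then show ?case using m_Suc[of "n + k"] t(1)[of "n + k"] that by simp
    qed simp
    moreover have "(\<lambda>k. m (n + k)) \<longlonglongrightarrow> 0"
      using LIMSEQ_ignore_initial_segment[OF m_lim, of n] by (simp add: add.commute)
    ultimately have "0 \<le> m n" by (intro LIMSEQ_le_const2) auto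
    then show False using neg by simp
  qed
  have "m (N + k) \<le> (4/5) ^ k * m N" for k
  proof (induction k)
    case (Suc k)
    have "m (N + k) / 5 \<le> t (N + k)"
    proof -
      have "\<bar>m (N + k)\<bar> \<le> 5/4 * cmod (1 - u (N + k))" using N[of "N + k"] by simp
      then show ?thesis using t(2)[of "N + k"] by linarith
    qed
    then have "m (N + Suc k) \<le> 4/5 * m (N + k)" using m_Suc[of "N + k"] by simp
    then show ?case using Suc by simp
  qed simp
  \<comment> \<open>The next value \<open>m (Suc (N + k))\<close> is nonnegative, so the current one
    is at least the rotation, which is at least a quarter of the distance to 1 and hence of the gap
    to the circle.\<close>
  moreover have "(5/6) ^ (N + k) * (1 - cmod w) / 4 \<le> m (N + k)" for k
    using gap[of "N + k"] norm_triangle_ineq2[of 1 "u (N + k)"] t(2)[of "N + k"]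
      m_Suc[of "N + k"] m_nonneg[of "Suc (N + k)"] by simp
  ultimately have "(5/6) ^ (N + k) * (1 - cmod w) / 4 \<le> (4/5) ^ k * m N" for k
    using order_trans by blast
  \<comment> \<open>Multiplying by (6/5)^k removes the decay on the left and leaves (6/5 * 4/5)^k =
    (24/25)^k on the right.\<close>
  then have "(5/6) ^ N * (1 - cmod w) / 4 \<le> (24/25) ^ k * m N" for k
  proof -
    have "(6/5) ^ k * ((5/6) ^ (N + k) * (1 - cmod w) / 4) \<le> (6/5) ^ k * ((4/5) ^ k * m N)"
      using \<open>\<And>k. (5/6) ^ (N + k) * (1 - cmod w) / 4 \<le> (4/5) ^ k * m N\<close>[of k] by (intro mult_left_mono) auto
    also have "(6/5) ^ k * ((4/5) ^ k * m N) = ((6/5) ^ k * (4/5) ^ k) * m N" by (rule mult.assoc[symmetric])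
    also have "(6/5::real) ^ k * (4/5) ^ k = (24/25) ^ k" by (simp flip: power_mult_distrib)
    also have "(6/5) ^ k * ((5/6) ^ (N + k) * (1 - cmod w) / 4)
        = ((6/5) ^ k * (5/6) ^ k) * ((5/6) ^ N * (1 - cmod w) / 4)"
      by (simp only: power_add mult_ac times_divide_eq_right)
    also have "(6/5::real) ^ k * (5/6) ^ k = 1" by (simp flip: power_mult_distrib)
    finally show ?thesis by simp
  qed
  moreover have "(\<lambda>k. (24/25::real) ^ k * m N) \<longlonglongrightarrow> 0 * m N"
    by (intro tendsto_intros LIMSEQ_power_zero) simp
  ultimately have "(5/6) ^ N * (1 - cmod w) / 4 \<le> 0 * m N"
    by (intro LIMSEQ_le_const) auto
  moreover have "0 < (5/6) ^ N * (1 - cmod w)" using w(2) by simp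
  ultimately show False by linarith
qed

section \<open>The bounded component and the essential singularity\<close>

lemma plane_map_funpow:
  "(plane_map ^^ n) x = vec2_of_complex ((qr_map ^^ n) (complex_of_vec2 x))"
  by (induction n) (simp_all add: plane_map_def)

lemma escaping_set_plane_map:
  "x \<in> escaping_set plane_map \<longleftrightarrow>
     filterlim (\<lambda>n. cmod ((qr_map ^^ n) (complex_of_vec2 x))) at_top sequentially"
  by (simp add: escaping_set_def filterlim_at_infinity_conv_norm_at_top plane_map_funpow)

lemma filterlim_escaping_orbit:
  "filterlim (\<lambda>n. cmod (of_real (1 + 2 * (6/5) ^ n))) at_top sequentially"
proof (rule filterlim_at_top_mono)
  show "filterlim (\<lambda>n. (6/5 :: real) ^ n) at_top sequentially"
    using filterlim_at_infinity_imp_norm_at_top[OF filterlim_realpow_sequentially_gt1[of "6/5 :: real"]]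
    by (simp add: norm_power)
  show "\<forall>\<^sub>F n in sequentially. (6/5) ^ n \<le> cmod (of_real (1 + 2 * (6/5) ^ n))"
  proof (intro always_eventually allI)
    fix n
    have "0 \<le> (6/5 :: real) ^ n" by simp
    then show "(6/5) ^ n \<le> cmod (of_real (1 + 2 * (6/5) ^ n))"
      unfolding norm_of_real by linarith
  qed
qed

lemma vec2_3_escapes: "vec2_of_complex 3 \<in> escaping_set plane_map"
  using filterlim_escaping_orbit by (simp add: escaping_set_plane_map qr_map_funpow_3)

text \<open>Since \<open>cayley_inv u = 1 - 2 / (u + 1)\<close>, escape of an orbit in the right
  half-plane would make the conjugate orbit in the disc converge to 1.\<close>

lemma not_escaping_of_phase_le:
  assumes z: "0 < Re z" "z \<noteq> 1" "phase (cmod (cayley_inv z)) \<le> 1/2"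
  shows "vec2_of_complex z \<notin> escaping_set plane_map"
proof
  assume "vec2_of_complex z \<in> escaping_set plane_map"
  then have inf: "filterlim (\<lambda>n. (qr_map ^^ n) z) at_infinity sequentially"
    by (simp add: escaping_set_plane_map filterlim_at_infinity_conv_norm_at_top)
  have z1: "u + 1 \<noteq> 0" if "0 < Re u" for u
    using that by (intro Re_nonneg_imp_plus_1_neq_0) simp
  have "filterlim (\<lambda>n. (qr_map ^^ n) z + 1) at_infinity sequentially"
    by (rule tendsto_add_filterlim_at_infinity'[OF inf tendsto_const])
  from tendsto_diff[OF tendsto_const tendsto_mult_right_zero[OF filterlim_compose[OF tendsto_inverse_0 this]], of 1 2]
  have "(\<lambda>n. 1 - 2 * inverse ((qr_map ^^ n) z + 1)) \<longlonglongrightarrow> 1" by simp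
  moreover have "1 - 2 * inverse ((qr_map ^^ n) z + 1) = (disc_map ^^ n) (cayley_inv z)" for n
  proof -
    have "1 - 2 * inverse (u + 1) = cayley_inv u" if "u + 1 \<noteq> 0" for u
      using that by (simp add: cayley_inv_def field_simps)
    then show ?thesis
      using qr_map_funpow[OF z(1)] z1 by metis
  qed
  ultimately have "(\<lambda>n. (disc_map ^^ n) (cayley_inv z)) \<longlonglongrightarrow> 1" by simp
  moreover have "cayley_inv z \<noteq> 0" "cmod (cayley_inv z) < 1"
    using z z1 by (auto simp: cayley_inv_eq_0_iff cmod_cayley_inv_less_1)
  ultimately show False using disc_map_orbit_not_tendsto_1 z(3) by blast
qed

lemma isCont_tendsto_nhds: "isCont f x \<Longrightarrow> (f \<longlongrightarrow> f x) (nhds x)"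
  by (simp add: isCont_def tendsto_at_iff_tendsto_nhds)

text \<open>A circle all of whose nearby points fail to escape separates the escaping point 3 from
  infinity in the closure of the escaping set, so the component of 3 is trapped in the disc
  \<open>U\<close>.\<close>

lemma bounded_component:
  "\<exists>C \<in> components (closure (escaping_set plane_map)). bounded C"
proof -
  \<comment> \<open>The radius of phase 0 midway, in the logarithmic scale, between the radii 1/2
    and 6/11 of the first two points of the escaping orbit. The point 3 has radius 1/2 and so lies
    inside.\<close>
  define \<rho> :: real where "\<rho> = sqrt (6/5) / (1 + sqrt (6/5))"
  have \<rho>: "1/2 < \<rho>" "\<rho> < 1" "\<rho> / (1 - \<rho>) = sqrt (6/5)"
  proof -
    have "1/2 < q / (1 + q)" "q / (1 + q) < 1" "q / (1 + q) / (1 - q / (1 + q)) = q"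
      if "1 < q" for q :: real
    proof -
      have "1 - q / (1 + q) = 1 / (1 + q)" using that by (simp add: divide_simps)
      then show "q / (1 + q) / (1 - q / (1 + q)) = q" using that by simp
    qed (use that in \<open>simp_all add: field_simps\<close>)
    from this[of "sqrt (6/5)"] show "1/2 < \<rho>" "\<rho> < 1" "\<rho> / (1 - \<rho>) = sqrt (6/5)"
      unfolding \<rho>_def by simp_all
  qed
  have phase_\<rho>: "phase \<rho> = 0"
    unfolding phase_def \<rho>(3) by (simp add: ln_sqrt cos_pi_half)
  let ?c = complex_of_vec2
  \<comment> \<open>The region \<open>cmod (cayley_inv z) < \<rho>\<close> with the denominator
    cleared; the pole -1 does not satisfy the inequality. It is a disc of Apollonius.\<close>
  define U where "U = {x. cmod (?c x - 1) < \<rho> * cmod (?c x + 1)}"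
  have cc: "continuous_on S ?c" for S
    by (rule linear_continuous_on[OF bounded_linear_complex_of_vec2])
  have "open U"
    unfolding U_def by (intro open_Collect_less continuous_intros cc)
  have "closure U \<subseteq> {x. cmod (?c x - 1) \<le> \<rho> * cmod (?c x + 1)}"
    by (rule closure_minimal) (auto simp: U_def intro!: closed_Collect_le continuous_intros cc)
  then have frontier: "cmod (?c x - 1) = \<rho> * cmod (?c x + 1)" if "x \<in> frontier U" for x
    using that \<open>open U\<close> by (force simp: frontier_def interior_open U_def)
  have "closure (escaping_set plane_map) \<inter> frontier U = {}"
  proof (rule ccontr)
    assume "closure (escaping_set plane_map) \<inter> frontier U \<noteq> {}"
    then obtain x where x: "x \<in> closure (escaping_set plane_map)" "x \<in> frontier U" by blast
    let ?z = "?c x"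
    note eq = frontier[OF x(2)]
    have z1: "?z + 1 \<noteq> 0"
    proof
      assume 0: "?z + 1 = 0"
      then have "?z - 1 = 0" using eq by simp
      then show False using 0 by (simp add: complex_eq_iff)
    qed
    then have "\<rho> * cmod (?z + 1) < 1 * cmod (?z + 1)"
      using \<rho> by (intro mult_strict_right_mono) auto
    then have "(cmod (?z - 1))\<^sup>2 < (cmod (?z + 1))\<^sup>2"
      unfolding eq using \<rho> by (intro power_strict_mono) auto
    then have Re: "0 < Re ?z" unfolding cmod_minus_1_power2 by simp
    have inv: "cmod (cayley_inv ?z) = \<rho>"
      using eq z1 by (simp add: cayley_inv_def norm_divide)
    have isc: "isCont (\<lambda>z. cmod (cayley_inv z)) ?z"
      unfolding cayley_inv_def by (intro continuous_intros) (use z1 in auto)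
    \<comment> \<open>The circle itself being free of escaping points would not suffice for the
      closure. As the phase is 0 there, it stays below 1/2 on a neighbourhood, which is then free of
      them too.\<close>
    have "isCont (\<lambda>z. phase (cmod (cayley_inv z))) ?z"
      by (rule isCont_o2[OF isc phase_continuous]) (use \<rho> inv in auto)
    then have "\<forall>\<^sub>F z in nhds ?z. phase (cmod (cayley_inv z)) < 1/2"
      by (intro order_tendstoD(2)[OF isCont_tendsto_nhds]) (simp_all add: inv phase_\<rho>)
    moreover have "\<forall>\<^sub>F z in nhds ?z. 0 < cmod (cayley_inv z)"
      by (rule order_tendstoD(1)[OF isCont_tendsto_nhds[OF isc]]) (use inv \<rho> in simp)
    moreover have "\<forall>\<^sub>F z in nhds ?z. 0 < Re z"
      using eventually_nhds_in_open[OF open_halfspace_Re_gt[of 0], of ?z] Re by simp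
    ultimately have "\<forall>\<^sub>F z in nhds ?z. vec2_of_complex z \<notin> escaping_set plane_map"
    proof eventually_elim
      case (elim z)
      then show ?case by (intro not_escaping_of_phase_le) (auto simp: cayley_inv_def)
    qed
    then obtain T where T: "open T" "?z \<in> T" "\<And>z. z \<in> T \<Longrightarrow> vec2_of_complex z \<notin> escaping_set plane_map"
      unfolding eventually_nhds by blast
    have "open (?c -` T)"
      using T(1) cc[of UNIV] by (simp add: open_vimage)
    moreover have "x \<in> ?c -` T" using T(2) by simp
    ultimately obtain y where "y \<in> ?c -` T" "y \<in> escaping_set plane_map"
      using x(1) open_Int_closure_eq_empty[of "?c -` T" "escaping_set plane_map"] by blast
    then show False using T(3)[of "?c y"] by simp
  qed
  moreover define C where "C = connected_component_set (closure (escaping_set plane_map)) (vec2_of_complex 3)"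
  moreover have mem: "vec2_of_complex 3 \<in> closure (escaping_set plane_map)"
    using vec2_3_escapes closure_subset by blast
  moreover have CU: "vec2_of_complex 3 \<in> C \<inter> U"
    using mem \<rho>(1) by (auto simp: C_def U_def)
  ultimately have "C \<inter> frontier U = {}"
    using connected_component_subset by blast
  moreover have "connected C"
    unfolding C_def by (rule connected_connected_component)
  ultimately have "C \<subseteq> U"
    using connected_Int_frontier[of C U] CU by blast
  moreover have "bounded U"
  proof (rule boundedI)
    fix x assume "x \<in> U"
    then have "cmod (?c x - 1) < \<rho> * cmod (?c x + 1)" by (simp add: U_def)
    moreover have "cmod (?c x) - 1 \<le> cmod (?c x - 1)"
      using norm_triangle_ineq2[of "?c x" 1] by simp
    moreover have "\<rho> * cmod (?c x + 1) \<le> \<rho> * (norm x + 1)"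
      using norm_triangle_ineq[of "?c x" 1] \<rho> by (intro mult_left_mono) auto
    ultimately have "norm x * (1 - \<rho>) \<le> 1 + \<rho>" by (simp add: algebra_simps)
    then show "norm x \<le> (1 + \<rho>) / (1 - \<rho>)" using \<rho> by (simp add: pos_le_divide_eq)
  qed
  ultimately have "bounded C" using bounded_subset by blast
  moreover have "C \<in> components (closure (escaping_set plane_map))"
    using mem by (auto simp: C_def components_def)
  ultimately show ?thesis by blast
qed

section \<open>Preimages, zeros and the essential singularity\<close>

lemma disc_map_surj:
  assumes "cmod W < 1"
  obtains w where "cmod w < 1" "disc_map w = W"
proof (cases "W = 0")
  case True
  then show ?thesis using that[of 0] by simp
next
  case False
  define R where "R = cmod W"
  have R: "0 < R" "R < 1" using False assms by (auto simp: R_def)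
  \<comment> \<open>The inverse of the radius map, so that only the angle remains to be
    found.\<close>
  define r where "r = 5 * R / (6 - R)"
  have r: "0 < r" "r < 1" using R by (auto simp: r_def field_simps)
  have "5 + r = 30 / (6 - R)" using R by (simp add: r_def divide_simps)
  then have rR: "6 / (5 + r) * r = R" using R by (simp add: r_def)
  define h where "h \<theta> = \<theta> + twist_angle (of_real r * cis \<theta>)" for \<theta>
  have norm: "cmod (of_real r * cis \<theta>) = r" for \<theta> using r by (simp add: norm_mult)
  have tw: "isCont twist_angle (of_real r * cis \<theta>)" for \<theta>
  proof (rule has_derivative_continuous[OF twist_angle_has_derivative])
    show "of_real r * cis \<theta> \<noteq> 0" using r by simp
    show "cmod (of_real r * cis \<theta>) < 1" using r norm[of \<theta>] by simp
  qed
  have "isCont (\<lambda>\<theta>. of_real r * cis \<theta>) \<theta>" for \<theta>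
    unfolding cis_conv_exp by (intro continuous_intros)
  from isCont_o2[OF this tw] have "isCont h \<theta>" for \<theta>
    unfolding h_def by (intro continuous_add continuous_ident)
  then have cont: "continuous_on UNIV h"
    by (simp add: continuous_at_imp_continuous_on)
  have ta: "0 \<le> twist_angle (of_real r * cis \<theta>)" "twist_angle (of_real r * cis \<theta>) \<le> 1" for \<theta>
  proof -
    let ?w = "of_real r * cis \<theta>"
    have "cmod ?w \<le> 1" using norm[of \<theta>] r by simp
    note b = twist_angle_bounds(1,2)[OF this]
    have "cmod (1 - ?w) \<le> 1 + r" using norm_triangle_ineq4[of 1 ?w] norm[of \<theta>] by simp
    then show "0 \<le> twist_angle ?w" "twist_angle ?w \<le> 1" using b r by linarith+
  qed
  \<comment> \<open>The rotation angle lies between 0 and 1, so \<open>h\<close> passes from at most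
    \<open>Arg W\<close> to at least \<open>Arg W\<close> on an interval of length 1.\<close>
  have "\<exists>\<theta>\<ge>Arg W - 1. \<theta> \<le> Arg W \<and> h \<theta> = Arg W"
  proof (rule IVT')
    show "h (Arg W - 1) \<le> Arg W" using ta(2)[of "Arg W - 1"] by (simp only: h_def)
    show "Arg W \<le> h (Arg W)" using ta(1)[of "Arg W"] by (simp only: h_def)
    show "continuous_on {Arg W - 1..Arg W} h" using cont by (rule continuous_on_subset) simp
  qed simp
  then obtain \<theta> where "h \<theta> = Arg W" by blast
  have "disc_map (of_real r * cis \<theta>) = of_real (6 / (5 + r) * r) * (cis (twist_angle (of_real r * cis \<theta>)) * cis \<theta>)"
    unfolding disc_map_def norm by (simp only: of_real_mult mult_ac)
  also have "\<dots> = of_real R * cis (h \<theta>)"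
    unfolding rR by (simp add: cis_mult h_def add.commute)
  also have "\<dots> = W"
    using rcis_cmod_Arg[of W] \<open>h \<theta> = Arg W\<close> by (simp add: rcis_def R_def)
  finally show ?thesis using that[of "of_real r * cis \<theta>"] norm r by simp
qed

lemma mirror_map_surj_left:
  assumes "Re u < 0"
  obtains z where "mirror_map z = u"
proof -
  have p: "0 < Re (- cnj u)" using assms by simp
  obtain w where w: "cmod w < 1" "disc_map w = cayley_inv (- cnj u)"
    using disc_map_surj[OF cmod_cayley_inv_less_1[OF p]] by blast
  have "w \<noteq> 1" using w(1) by auto
  then have "half_plane_map (cayley w) = cayley (cayley_inv (- cnj u))"
    by (simp add: half_plane_map_def cayley_inv_cayley w(2))
  also have "\<dots> = - cnj u"
    using p by (intro cayley_cayley_inv Re_nonneg_imp_plus_1_neq_0) simp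
  finally have h: "half_plane_map (cayley w) = - cnj u" .
  have "(cmod w)\<^sup>2 < 1" using w(1) by (simp add: abs_square_less_1)
  then have "0 < Re (cayley w)" using \<open>w \<noteq> 1\<close> unfolding Re_cayley by simp
  then have "mirror_map (- cnj (cayley w)) = u"
    by (simp add: mirror_map_def h)
  then show ?thesis by (rule that)
qed

text \<open>With \<open>u = - x + \<i> * Y\<close> and \<open>Y = P + s\<close>, where
  \<open>P\<close> is a multiple of \<open>2 * pi\<close>, the equation
  \<open>60 * u + exp (- u) = 0\<close> splits into \<open>exp x * cos s = 60 * x\<close> and
  \<open>exp x * sin s = 60 * Y\<close>. Division gives \<open>x = Y * cos s / sin s\<close>, and
  one real equation for \<open>s\<close> remains; large \<open>P\<close> gives large zeros.\<close>

lemma exp_shear_zeros: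
  obtains u where "exp_shear u = 0" "Re u < 0" "B \<le> cmod u"
proof -
  obtain k0 :: nat where k0: "B < real k0" using reals_Archimedean2 by blast
  \<comment> \<open>The summand 40 gives \<open>P \<ge> 240\<close>, because \<open>pi > 3\<close>.
    At \<open>s = pi / 4\<close> this makes a quarter of the square of \<open>P + s\<close> exceed
    \<open>60 * (P + s)\<close>, and a quarter of the square is what the Taylor bound for
    \<open>exp\<close> provides.\<close>
  define n where "n = k0 + 40"
  define P where "P = 2 * real n * pi"
  have P: "B \<le> P" "240 \<le> P"
  proof -
    have "2 * real n * 3 \<le> P" unfolding P_def using pi_gt3 by (intro mult_left_mono) auto
    then show "B \<le> P" "240 \<le> P" using k0 by (auto simp: n_def)
  qed
  define g where "g s = sin s * exp ((P + s) * (cos s / sin s)) / 60 - (P + s)" for s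
  have sin_pos: "0 < sin s" if "pi / 4 \<le> s" "s \<le> pi / 2" for s
    using that pi_gt3 by (intro sin_gt_zero) auto
  have "\<exists>s\<ge>pi / 4. s \<le> pi / 2 \<and> g s = 0"
  proof (rule IVT2')
    show "g (pi / 2) \<le> 0" using P(2) pi_gt3 by (simp add: g_def)
    show "0 \<le> g (pi / 4)"
    proof -
      let ?Y = "P + pi / 4"
      have Y: "240 \<le> ?Y" using P(2) pi_gt3 by simp
      have "?Y * ?Y / 2 \<le> exp ?Y"
        using exp_lower_Taylor_quadratic[of ?Y] Y unfolding power2_eq_square by linarith
      moreover have "(1/2 :: real) \<le> sqrt 2 / 2" by simp
      ultimately have "1/2 * (?Y * ?Y / 2) \<le> sqrt 2 / 2 * exp ?Y"
        using Y by (intro mult_mono) auto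
      moreover have "240 * ?Y \<le> ?Y * ?Y" using Y by (intro mult_right_mono) auto
      moreover have "y \<le> A / 60" if "1/2 * (X / 2) \<le> A" "240 * y \<le> X" for X y A :: real
        using that by linarith
      ultimately have "?Y \<le> sqrt 2 / 2 * exp ?Y / 60" by blast
      then show ?thesis by (simp add: g_def sin_45 cos_45)
    qed
    show "pi / 4 \<le> pi / 2" by simp
    show "continuous_on {pi / 4..pi / 2} g"
      unfolding g_def using sin_pos by (intro continuous_intros) force+
  qed
  then obtain s where s: "pi / 4 \<le> s" "s \<le> pi / 2" "g s = 0" by blast
  define Y where "Y = P + s"
  have sn: "0 < sin s" using sin_pos s by blast
  define E where "E = exp (Y * (cos s / sin s))"
  have E: "sin s * E = 60 * Y" using s(3) by (simp add: g_def E_def Y_def)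
  have Y: "240 \<le> Y" "P \<le> Y" using P s(1) pi_gt3 by (auto simp: Y_def)
  \<comment> \<open>The size of \<open>E\<close> puts \<open>Re u\<close> below -1, where the cutoff
    is constantly 1/60; only there is a zero of the entire formula a zero of
    \<open>exp_shear\<close>.\<close>
  have "sin s * E \<le> 1 * E" by (intro mult_right_mono) (auto simp: E_def)
  then have "3 < E" using E Y by linarith
  then have "exp 1 < E" using exp_le by linarith
  then have one: "1 < Y * (cos s / sin s)" by (simp add: E_def)
  define u where "u = Complex (- (Y * (cos s / sin s))) Y"
  have tr: "sin Y = sin s" "cos Y = cos s"
    by (simp_all add: Y_def P_def sin_add cos_add)
  have "exp (- u) = of_real E * cis (- Y)"
    by (simp add: exp_eq_polar u_def E_def)
  then have "exp_shear u = u + of_real (1/60) * (of_real E * cis (- Y))"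
    using one by (simp add: exp_shear_def cutoff_values u_def)
  moreover have "E = 60 * Y / sin s" using E sn by (simp add: field_simps)
  ultimately have "exp_shear u = 0"
    using sn by (simp add: complex_eq_iff u_def tr)
  moreover have "Re u < 0" using one by (simp add: u_def)
  moreover have "B \<le> cmod u"
    using abs_Im_le_cmod[of u] Y P by (simp add: u_def)
  ultimately show ?thesis by (rule that)
qed

text \<open>The escaping orbit on the right rules out a finite limit. The limit infinity is ruled
  out by zeros of the map of arbitrarily large modulus, obtained as preimages under
  \<open>mirror_map\<close> of large zeros of \<open>exp_shear\<close>.\<close>

lemma essential_singularity_plane_map: "essential_singularity_at_infinity plane_map"
  unfolding essential_singularity_at_infinity_def
proof (intro conjI notI)
  let ?o = "\<lambda>n. vec2_of_complex (of_real (1 + 2 * (6/5) ^ n))"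
  have o: "filterlim ?o at_infinity sequentially"
    unfolding filterlim_at_infinity_conv_norm_at_top norm_vec2_of_complex
    by (rule filterlim_escaping_orbit)
  assume "\<exists>l. (plane_map \<longlongrightarrow> l) at_infinity"
  then obtain l where "(plane_map \<longlongrightarrow> l) at_infinity" by blast
  then have "(\<lambda>n. plane_map (?o n)) \<longlonglongrightarrow> l" using o by (rule filterlim_compose)
  \<comment> \<open>The map shifts this sequence, so a finite limit along it would be the limit of
    the sequence itself, which is unbounded.\<close>
  moreover have "plane_map (?o n) = ?o (Suc n)" for n
    by (simp only: plane_map_def complex_of_vec2_inverse qr_map_escaping_orbit)
  ultimately have "(\<lambda>n. ?o (Suc n)) \<longlonglongrightarrow> l" by (simp only:)
  then have "?o \<longlonglongrightarrow> l" by (rule LIMSEQ_imp_Suc[of ?o l])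
  then show False
    using o not_tendsto_and_filterlim_at_infinity[of sequentially ?o l] by simp
next
  assume "filterlim plane_map at_infinity at_infinity"
  then have "filterlim (\<lambda>x. norm (plane_map x)) at_top at_infinity"
    by (simp only: filterlim_at_infinity_conv_norm_at_top)
  then have "\<forall>\<^sub>F x in at_infinity. 1 \<le> norm (plane_map x)"
    by (simp add: filterlim_at_top)
  then obtain b where b: "\<And>x. b \<le> norm x \<Longrightarrow> 1 \<le> norm (plane_map x)"
    unfolding eventually_at_infinity by blast
  have "compact (mirror_map ` cball 0 b)"
    by (rule compact_continuous_image[OF continuous_on_subset[OF mirror_map_continuous] compact_cball]) simp
  then have "bounded (mirror_map ` cball 0 b)" by (rule compact_imp_bounded)
  then obtain B where "\<forall>w\<in>mirror_map ` cball 0 b. cmod w \<le> B"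
    unfolding bounded_iff by blast
  then have B: "cmod (mirror_map z) \<le> B" if "cmod z \<le> b" for z using that by simp
  \<comment> \<open>A zero of modulus above \<open>B\<close> is not in the image of the ball of
    radius \<open>b\<close>, so its preimage lies outside that ball, where the map should have norm
    at least 1.\<close>
  obtain u where u: "exp_shear u = 0" "Re u < 0" "B + 1 \<le> cmod u"
    by (rule exp_shear_zeros)
  obtain z where z: "mirror_map z = u" using mirror_map_surj_left[OF u(2)] by blast
  have "norm (plane_map (vec2_of_complex z)) = 0"
    by (simp add: plane_map_def qr_map_def z u(1))
  then have "norm (vec2_of_complex z) < b" using b[of "vec2_of_complex z"] by force
  then have "cmod u \<le> B" using B[of z] z by simp
  then show False using u(3) by simp
qed

theorem mainTheorem2:
  "\<exists>f :: real^2 \<Rightarrow> real^2. quasiregular f \<and> essential_singularity_at_infinity f \<and>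
     (\<exists>C \<in> components (closure (escaping_set f)). bounded C)"
  using quasiregular_plane_map essential_singularity_plane_map bounded_component by blast

end
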